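(* There exist an FS-domain $X$ and an algebraic domain $L$ such that the Scott function space $[X\to L]$ is not continuous.
   Context: A dcpo is a poset in which every directed (in particular nonempty) subset has a supremum. A map between dcpos is Scott-continuous if it is monotone and preserves suprema of directed subsets. For dcpos $D,E$, the Scott function space $[D\to E]$ is the dcpo of all Scott-continuous maps $D\to E$ with the pointwise order; directed suprema are computed pointwise. In a dcpo $D$, $a$ is way below $x$, written $a\ll x$, if for every directed $A\subseteq D$ with $x\le\bigvee A$ there is $y\in A$ with $a\le y$. A dcpo $D$ is continuous if for every $x\in D$ the set $\{a\in D: a\ll x\}$ is directed and has supremum $x$. An element $k$ is compact if $k\ll k$; an algebraic domain is a dcpo in which, for every $x$, the set of compact elements below $x$ is directed with supremum $x$. A Scott-continuous map $f:D\to D$ is finitely separated from the identity if there is a finite set $M\subseteq D$ such that for every $x\in D$ there is $m\in M$ with $f(x)\le m\le x$. An FS-domain is a continuous dcpo $D$ for which there is a directed family (pointwise order) $(f_i)_{i\in I}$ of Scott-continuous maps $D\to D$, each finitely separated from the identity, with $x=\bigvee_{i\in I}f_i(x)$ for every $x\in D$. *)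

theory Defs
  imports Complex_Main "HOL-Algebra.Order"
begin

text \<open>
  HOL has no existential quantifier over types, so existence of a domain means existence of
  a poset whose carrier is a subset of one sufficiently large type. All notions below are
  relative to the carrier and invariant under order isomorphism.

  Posets are the carrier-based partial orders of \<^theory>\<open>HOL-Algebra.Order\<close>; the statement
  \<open>least D s (Upper D A)\<close> says that \<open>s\<close> is the supremum of \<open>A\<close> in \<open>D\<close>.
\<close>

abbreviation is_supremum :: "('a, 'b) gorder_scheme \<Rightarrow> 'a \<Rightarrow> 'a set \<Rightarrow> bool" where
  "is_supremum D s A \<equiv> least D s (Upper D A)"

definition directed_in :: "('a, 'b) gorder_scheme \<Rightarrow> 'a set \<Rightarrow> bool" where
  "directed_in D A \<longleftrightarrow> A \<subseteq> carrier D \<and> A \<noteq> {} \<and>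
     (\<forall>x\<in>A. \<forall>y\<in>A. \<exists>z\<in>A. x \<sqsubseteq>\<^bsub>D\<^esub> z \<and> y \<sqsubseteq>\<^bsub>D\<^esub> z)"

locale dcpo = partial_order +
  assumes directed_has_supremum: "directed_in L A \<Longrightarrow> \<exists>s. is_supremum L s A"

definition scott_continuous ::
  "('a, 'c) gorder_scheme \<Rightarrow> ('b, 'd) gorder_scheme \<Rightarrow> ('a \<Rightarrow> 'b) \<Rightarrow> bool" where
  "scott_continuous D E f \<longleftrightarrow>
     f \<in> carrier D \<rightarrow> carrier E \<and> isotone D E f \<and>
     (\<forall>A s. directed_in D A \<longrightarrow> is_supremum D s A \<longrightarrow> is_supremum E (f s) (f ` A))"

text \<open>
  Maps are taken to be \<open>undefined\<close> outside the carrier of the domain (\<open>\<rightarrow>\<^sub>E\<close>), so that HOL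
  equality of elements of the function space is equality of maps from \<open>D\<close> to \<open>E\<close>.
\<close>

definition scott_function_space ::
  "('a, 'c) gorder_scheme \<Rightarrow> ('b, 'd) gorder_scheme \<Rightarrow> ('a \<Rightarrow> 'b) gorder" where
  "scott_function_space D E =
     \<lparr>carrier = {f \<in> carrier D \<rightarrow>\<^sub>E carrier E. scott_continuous D E f},
      eq = (=),
      le = (\<lambda>f g. \<forall>x\<in>carrier D. f x \<sqsubseteq>\<^bsub>E\<^esub> g x)\<rparr>"

definition way_below :: "('a, 'b) gorder_scheme \<Rightarrow> 'a \<Rightarrow> 'a \<Rightarrow> bool" where
  "way_below D a x \<longleftrightarrow> a \<in> carrier D \<and> x \<in> carrier D \<and>
     (\<forall>A s. directed_in D A \<longrightarrow> is_supremum D s A \<longrightarrow> x \<sqsubseteq>\<^bsub>D\<^esub> s \<longrightarrow> (\<exists>y\<in>A. a \<sqsubseteq>\<^bsub>D\<^esub> y))"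

abbreviation compact_element :: "('a, 'b) gorder_scheme \<Rightarrow> 'a \<Rightarrow> bool" where
  "compact_element D k \<equiv> way_below D k k"

locale continuous_dcpo = dcpo +
  assumes way_below_directed:
      "x \<in> carrier L \<Longrightarrow> directed_in L {a \<in> carrier L. way_below L a x}"
    and way_below_supremum:
      "x \<in> carrier L \<Longrightarrow> is_supremum L x {a \<in> carrier L. way_below L a x}"

locale algebraic_domain = dcpo +
  assumes compact_directed:
      "x \<in> carrier L \<Longrightarrow> directed_in L {k \<in> carrier L. compact_element L k \<and> k \<sqsubseteq> x}"
    and compact_supremum:
      "x \<in> carrier L \<Longrightarrow> is_supremum L x {k \<in> carrier L. compact_element L k \<and> k \<sqsubseteq> x}"

definition finitely_separated :: "('a, 'b) gorder_scheme \<Rightarrow> ('a \<Rightarrow> 'a) \<Rightarrow> bool" where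
  "finitely_separated D f \<longleftrightarrow>
     (\<exists>M. finite M \<and> M \<subseteq> carrier D \<and>
       (\<forall>x\<in>carrier D. \<exists>m\<in>M. f x \<sqsubseteq>\<^bsub>D\<^esub> m \<and> m \<sqsubseteq>\<^bsub>D\<^esub> x))"

locale FS_domain = continuous_dcpo +
  assumes approximation:
    "\<exists>F. directed_in (scott_function_space L L) F \<and>
         (\<forall>f\<in>F. finitely_separated L f) \<and>
         (\<forall>x\<in>carrier L. is_supremum L x ((\<lambda>f. f x) ` F))"

text \<open>
  The function space of two dcpos is a dcpo with pointwise suprema. Hence a failure of
  \<^const>\<open>continuous_dcpo\<close> for it is a failure of approximation, not of directed completeness.
\<close>

lemma partial_order_scott_function_space:
  assumes "partial_order D" "partial_order E"
  shows "partial_order (scott_function_space D E)"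
proof -
  interpret D: partial_order D by fact
  interpret E: partial_order E by fact
  show ?thesis
  proof (unfold_locales, goal_cases)
    case (5 f g)
    then have "f x = g x" if "x \<in> carrier D" for x
      using that by (auto simp: scott_function_space_def PiE_iff)
    then have "f = g"
      using 5 by (auto simp: scott_function_space_def intro: PiE_ext)
    then show ?case by (simp add: scott_function_space_def)
  next
    case (6 f g h)
    then show ?case
      by (auto simp: scott_function_space_def PiE_iff intro: E.le_trans)
  qed (auto simp: scott_function_space_def PiE_iff)
qed

lemma directed_in_eval:
  assumes "directed_in (scott_function_space D E) F" "x \<in> carrier D"
  shows "directed_in E ((\<lambda>f. f x) ` F)"
  using assms unfolding directed_in_def scott_function_space_def
  by (simp add: PiE_iff subset_iff) blast

lemma is_supremum_scott_function_space:
  assumes "dcpo D" "dcpo E" and F: "directed_in (scott_function_space D E) F"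
    and g_ext: "g \<in> extensional (carrier D)"
    and g: "\<And>x. x \<in> carrier D \<Longrightarrow> is_supremum E (g x) ((\<lambda>f. f x) ` F)"
  shows "is_supremum (scott_function_space D E) g F"
proof -
  interpret D: dcpo D by fact
  interpret E: dcpo E by fact
  have F_carrier: "f x \<in> carrier E" if "f \<in> F" "x \<in> carrier D" for f x
    using that F by (auto simp: directed_in_def scott_function_space_def PiE_iff)
  have F_cont: "scott_continuous D E f" if "f \<in> F" for f
    using that F by (auto simp: directed_in_def scott_function_space_def)
  have g_carrier: "g x \<in> carrier E" if "x \<in> carrier D" for x
    using g[OF that] by simp
  have upper: "f x \<sqsubseteq>\<^bsub>E\<^esub> g x" if "f \<in> F" "x \<in> carrier D" for f x
    by (rule least_Upper_above[OF g[OF that(2)]]) (use that F_carrier in auto)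
  have lower: "g x \<sqsubseteq>\<^bsub>E\<^esub> u"
    if "x \<in> carrier D" "u \<in> carrier E" "\<And>f. f \<in> F \<Longrightarrow> f x \<sqsubseteq>\<^bsub>E\<^esub> u" for x u
    by (rule least_le[OF g[OF that(1)]]) (use that in \<open>auto intro: Upper_memI\<close>)
  have F_mono: "f x \<sqsubseteq>\<^bsub>E\<^esub> f y"
    if "f \<in> F" "x \<in> carrier D" "y \<in> carrier D" "x \<sqsubseteq>\<^bsub>D\<^esub> y" for f x y
    using F_cont[OF that(1)] that(2-) by (auto simp: scott_continuous_def isotone_def)
  have mono: "g x \<sqsubseteq>\<^bsub>E\<^esub> g y" if "x \<in> carrier D" "y \<in> carrier D" "x \<sqsubseteq>\<^bsub>D\<^esub> y" for x y
  proof (rule lower)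
    fix f assume "f \<in> F"
    then show "f x \<sqsubseteq>\<^bsub>E\<^esub> g y"
      using that F_carrier g_carrier F_mono upper E.le_trans by meson
  qed (use that g_carrier in auto)
  have "is_supremum E (g s) (g ` A)" if A: "directed_in D A" and s: "is_supremum D s A" for A s
  proof (rule least_UpperI)
    have A_carrier: "A \<subseteq> carrier D" using A by (simp add: directed_in_def)
    have s_carrier: "s \<in> carrier D" using s by simp
    show "g ` A \<subseteq> carrier E" "g s \<in> carrier E"
      using A_carrier s_carrier g_carrier by auto
    show "y \<sqsubseteq>\<^bsub>E\<^esub> g s" if "y \<in> g ` A" for y
      using that A_carrier s_carrier mono least_Upper_above[OF s] by blast
    show "g s \<sqsubseteq>\<^bsub>E\<^esub> u" if u: "u \<in> Upper E (g ` A)" for u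
    proof (rule lower)
      show u_carrier: "u \<in> carrier E" using u by (auto simp: Upper_def)
      fix f assume f: "f \<in> F"
      have "f a \<sqsubseteq>\<^bsub>E\<^esub> u" if a: "a \<in> A" for a
      proof -
        have aD: "a \<in> carrier D" using a A_carrier by blast
        have "g a \<sqsubseteq>\<^bsub>E\<^esub> u" using u a aD g_carrier by (auto simp: Upper_def)
        then show ?thesis
          using E.le_trans[OF upper[OF f aD]] F_carrier[OF f aD] g_carrier[OF aD] u_carrier by blast
      qed
      then have "u \<in> Upper E (f ` A)" using u_carrier by (auto intro: Upper_memI)
      moreover have "is_supremum E (f s) (f ` A)"
        using F_cont[OF f] A s by (auto simp: scott_continuous_def)
      ultimately show "f s \<sqsubseteq>\<^bsub>E\<^esub> u" by (blast intro: least_le)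
    qed (rule s_carrier)
  qed
  moreover have "isotone D E g"
    by (rule isotoneI) (use mono in \<open>auto intro: D.weak_partial_order_axioms E.weak_partial_order_axioms\<close>)
  ultimately have "scott_continuous D E g"
    using g_carrier by (auto simp: scott_continuous_def)
  then have g_mem: "g \<in> carrier (scott_function_space D E)"
    using g_ext g_carrier by (auto simp: scott_function_space_def PiE_iff)
  show ?thesis
  proof (rule least_UpperI)
    show "F \<subseteq> carrier (scott_function_space D E)" using F by (simp add: directed_in_def)
    show "f \<sqsubseteq>\<^bsub>scott_function_space D E\<^esub> g" if "f \<in> F" for f
      using upper that by (auto simp: scott_function_space_def)
    show "g \<sqsubseteq>\<^bsub>scott_function_space D E\<^esub> h" if h: "h \<in> Upper (scott_function_space D E) F" for h
    proof -
      have "f \<sqsubseteq>\<^bsub>scott_function_space D E\<^esub> h" if "f \<in> F" for f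
        using Upper_memD[OF h that] F by (auto simp: directed_in_def)
      moreover have "h \<in> carrier (scott_function_space D E)"
        using h by (auto simp: Upper_def)
      ultimately show ?thesis
        by (auto simp: scott_function_space_def PiE_iff intro!: lower)
    qed
  qed (rule g_mem)
qed

lemma dcpo_scott_function_space:
  assumes "dcpo D" "dcpo E"
  shows "dcpo (scott_function_space D E)"
proof -
  interpret D: dcpo D by fact
  interpret E: dcpo E by fact
  interpret P: partial_order "scott_function_space D E"
    by (intro partial_order_scott_function_space D.partial_order_axioms E.partial_order_axioms)
  show ?thesis
  proof
    fix F assume F: "directed_in (scott_function_space D E) F"
    define g where "g = (\<lambda>x\<in>carrier D. SOME s. is_supremum E s ((\<lambda>f. f x) ` F))"
    have "is_supremum E (g x) ((\<lambda>f. f x) ` F)" if "x \<in> carrier D" for x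
      using that someI_ex[OF E.directed_has_supremum[OF directed_in_eval[OF F that]]]
      by (simp add: g_def)
    then have "is_supremum (scott_function_space D E) g F"
      by (intro is_supremum_scott_function_space assms F) (simp_all add: g_def)
    then show "\<exists>s. is_supremum (scott_function_space D E) s F" by blast
  qed
qed

end

theory Submission
  imports Defs "HOL-Analysis.Continuum_Not_Denumerable"
begin

text \<open>
The domain \<open>X\<close> has a bottom element and, above it, the events \<open>(x, y, t)\<close> of a
square of space during a bounded interval of time, where \<open>(x, y, t) \<le> (x', y', t')\<close> means
\<open>\<bar>x' - x\<bar> + \<bar>y' - y\<bar> \<le> t' - t\<close>: the second event lies in the light cone of the first one.
(Read as the closed ball about \<open>(x, y)\<close> of radius \<open>1 - t\<close> in the sum norm, an event is a formal
ball, and the order is formal reverse inclusion.) Moving every event back in time by \<open>\<epsilon>\<close> is a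
Scott-continuous map that a finite grid separates from the identity, so \<open>X\<close> is an FS-domain.

The algebraic domain \<open>L\<close> consists of the directed subsets of \<open>X\<close>, ordered by inclusion; its
compact elements are the finite directed sets. The map \<open>s\<close> that sends \<open>x\<close> to the set of all
\<open>a \<lless> x\<close> is Scott-continuous from \<open>X\<close> to \<open>L\<close>. The proof shows that \<open>s\<close> is not the supremum
of the maps way below it, by two facts.

A map \<open>h\<close> way below \<open>s\<close> involves only finitely many elements of \<open>X\<close>
(\<open>finite_values_of_way_below_approximants\<close>). For suppose that the sets \<open>h x\<close> contain distinct
non-bottom elements \<open>q\<^sub>0, q\<^sub>1, \<dots>\<close>. Countably many non-bottom elements can be removed from \<open>s x\<close> without
spoiling its directedness, because any two elements way below an event precede uncountably many events
that differ from it only by a slightly earlier time.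
So \<open>s\<close> is the increasing supremum of the maps \<open>x \<mapsto> s x - {q\<^sub>n | n \<ge> k}\<close>, none of which is
above \<open>h\<close>. Consequently, if the function space were continuous, then choosing the
greatest element of each finite directed set \<open>h x\<close> would give monotone maps \<open>\<delta> \<le> id\<close> that
have finitely many values and are as close to the identity as desired.

But there is no such \<open>\<delta>\<close> (\<open>no_finite_valued_approximation\<close>). Write its value as \<open>(X, Y, T)\<close>.
Being finite-valued, \<open>\<delta>\<close> changes only by jumping across surfaces. By
monotonicity each surface is a graph \<open>t = u(x, y)\<close> where \<open>u\<close> has slopes at most \<open>1\<close> in both space
directions, and the jump satisfies \<open>\<bar>\<Delta>X\<bar> + \<bar>\<Delta>Y\<bar> \<le> \<Delta>T\<close>. Such a jump contributes
\<open>- \<Delta>X \<partial>u/\<partial>x - \<Delta>Y \<partial>u/\<partial>y\<close> to the total of \<open>\<partial>X/\<partial>x + \<partial>Y/\<partial>y\<close> and the larger amount \<open>\<Delta>T\<close>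
to the total of \<open>\<partial>T/\<partial>t\<close>. Hence the mean of \<open>\<partial>X/\<partial>x + \<partial>Y/\<partial>y\<close> is at most the mean of \<open>\<partial>T/\<partial>t\<close>.
For a map close to the identity these means are close to \<open>2\<close> and to \<open>1\<close>.

The comparison is carried out with differences on a finite grid. It needs surfaces that
are either well apart or practically coincident on the scale of the difference step, because
only the combined jump across coincident surfaces is known to respect the order. As the number of
surfaces is fixed, a pigeonhole argument over many scales provides a suitable step
(\<open>few_exceptional\<close>).
\<close>

section \<open>Suprema and the way-below relation\<close>

lemma directed_in_common_upper_bound:
  "directed_in D A \<Longrightarrow> x \<in> A \<Longrightarrow> y \<in> A \<Longrightarrow> \<exists>z\<in>A. x \<sqsubseteq>\<^bsub>D\<^esub> z \<and> y \<sqsubseteq>\<^bsub>D\<^esub> z"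
  by (simp add: directed_in_def)

lemma way_belowD:
  assumes "way_below D a x" "directed_in D A" "is_supremum D s A" "x \<sqsubseteq>\<^bsub>D\<^esub> s"
  shows "\<exists>y\<in>A. a \<sqsubseteq>\<^bsub>D\<^esub> y"
  using assms unfolding way_below_def by blast

lemma way_belowI:
  assumes "a \<in> carrier D" "x \<in> carrier D"
    and "\<And>A s. directed_in D A \<Longrightarrow> is_supremum D s A \<Longrightarrow> x \<sqsubseteq>\<^bsub>D\<^esub> s \<Longrightarrow> \<exists>y\<in>A. a \<sqsubseteq>\<^bsub>D\<^esub> y"
  shows "way_below D a x"
  unfolding way_below_def by (intro conjI allI impI assms)

lemma way_below_carrier:
  "way_below D a x \<Longrightarrow> a \<in> carrier D" "way_below D a x \<Longrightarrow> x \<in> carrier D"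
  by (simp_all only: way_below_def)

lemma is_supremumI:
  assumes "A \<subseteq> carrier D" "s \<in> carrier D" "\<And>a. a \<in> A \<Longrightarrow> a \<sqsubseteq>\<^bsub>D\<^esub> s"
    and "\<And>u. u \<in> carrier D \<Longrightarrow> (\<And>a. a \<in> A \<Longrightarrow> a \<sqsubseteq>\<^bsub>D\<^esub> u) \<Longrightarrow> s \<sqsubseteq>\<^bsub>D\<^esub> u"
  shows "is_supremum D s A"
proof (rule least_UpperI)
  fix u assume u: "u \<in> Upper D A"
  show "s \<sqsubseteq>\<^bsub>D\<^esub> u"
  proof (rule assms(4))
    show "u \<in> carrier D" using u unfolding Upper_def by (rule IntD2)
    show "a \<sqsubseteq>\<^bsub>D\<^esub> u" if "a \<in> A" for a
      using Upper_memD[OF u that assms(1)] by (rule conjunct1)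
  qed
qed (use assms in auto)

lemma is_supremum_upper:
  "is_supremum D s A \<Longrightarrow> A \<subseteq> carrier D \<Longrightarrow> a \<in> A \<Longrightarrow> a \<sqsubseteq>\<^bsub>D\<^esub> s"
  by (rule least_Upper_above)

lemma is_supremum_least:
  "is_supremum D s A \<Longrightarrow> u \<in> carrier D \<Longrightarrow> (\<And>a. a \<in> A \<Longrightarrow> a \<sqsubseteq>\<^bsub>D\<^esub> u) \<Longrightarrow> s \<sqsubseteq>\<^bsub>D\<^esub> u"
  by (rule least_le[of D s "Upper D A"]) (assumption, rule Upper_memI)

lemma is_supremum_carrier: "is_supremum D s A \<Longrightarrow> s \<in> carrier D"
  by simp

lemma (in partial_order) is_supremum_unique:
  "is_supremum L s A \<Longrightarrow> is_supremum L s' A \<Longrightarrow> s = s'"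
  by (rule least_unique)

lemma directed_finite_upper_bound:
  assumes "partial_order D" and A: "directed_in D A" and "finite F" "F \<subseteq> A"
  shows "\<exists>z\<in>A. \<forall>a\<in>F. a \<sqsubseteq>\<^bsub>D\<^esub> z"
  using assms(3,4)
proof (induction F rule: finite_induct)
  case empty
  then show ?case using A unfolding directed_in_def by blast
next
  case (insert b F)
  interpret partial_order D by fact
  obtain m where m: "m \<in> A" "\<forall>a\<in>F. a \<sqsubseteq>\<^bsub>D\<^esub> m" using insert by auto
  have A_carrier: "A \<subseteq> carrier D" using A by (simp add: directed_in_def)
  have "\<exists>c\<in>A. m \<sqsubseteq>\<^bsub>D\<^esub> c \<and> b \<sqsubseteq>\<^bsub>D\<^esub> c"
    using insert.prems by (intro directed_in_common_upper_bound[OF A m(1)]) simp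
  then obtain c where c: "c \<in> A" "m \<sqsubseteq>\<^bsub>D\<^esub> c" "b \<sqsubseteq>\<^bsub>D\<^esub> c" by blast
  have "a \<sqsubseteq>\<^bsub>D\<^esub> c" if "a \<in> F" for a
    using that m c A_carrier insert.prems by (intro le_trans[of a m c]) auto
  then show ?case using c by auto
qed

lemma way_below_imp_le:
  assumes "partial_order D" "way_below D a x"
  shows "a \<sqsubseteq>\<^bsub>D\<^esub> x"
proof -
  interpret partial_order D by fact
  have x: "a \<in> carrier D" "x \<in> carrier D" using way_below_carrier[OF assms(2)] .
  have "directed_in D {x}" using x by (auto simp: directed_in_def)
  moreover have "is_supremum D x {x}" using x by (intro is_supremumI) auto
  ultimately show ?thesis using way_belowD[OF assms(2)] x by blast
qed

lemma way_below_le_trans: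
  assumes "partial_order D" "way_below D a x" "x \<sqsubseteq>\<^bsub>D\<^esub> y" "y \<in> carrier D"
  shows "way_below D a y"
proof -
  interpret partial_order D by fact
  show ?thesis
  proof (rule way_belowI)
    fix A s assume A: "directed_in D A" "is_supremum D s A" "y \<sqsubseteq>\<^bsub>D\<^esub> s"
    then have "x \<sqsubseteq>\<^bsub>D\<^esub> s"
      using is_supremum_carrier[OF A(2)] way_below_carrier(2)[OF assms(2)]
      by (intro le_trans[OF assms(3) A(3)] assms(4))
    then show "\<exists>z\<in>A. a \<sqsubseteq>\<^bsub>D\<^esub> z" by (rule way_belowD[OF assms(2) A(1,2)])
  qed (rule way_below_carrier(1)[OF assms(2)], rule assms(4))
qed

lemma le_way_below_trans:
  assumes "partial_order D" "a \<sqsubseteq>\<^bsub>D\<^esub> b" "way_below D b x" "a \<in> carrier D"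
  shows "way_below D a x"
proof -
  interpret partial_order D by fact
  show ?thesis
  proof (rule way_belowI)
    fix A s assume A: "directed_in D A" "is_supremum D s A" "x \<sqsubseteq>\<^bsub>D\<^esub> s"
    then obtain z where z: "z \<in> A" "b \<sqsubseteq>\<^bsub>D\<^esub> z"
      using way_belowD[OF assms(3)] by blast
    then have "a \<sqsubseteq>\<^bsub>D\<^esub> z"
      using way_below_carrier(1)[OF assms(3)] A(1)
      by (intro le_trans[OF assms(2) z(2)] assms(4)) (auto simp: directed_in_def)
    then show "\<exists>z\<in>A. a \<sqsubseteq>\<^bsub>D\<^esub> z" using z by blast
  qed (rule assms(4), rule way_below_carrier(2)[OF assms(3)])
qed

text \<open>
The elements way below some element that is itself way below \<open>x\<close> form a directed set, and its
supremum is still \<open>x\<close>; so anything way below \<open>x\<close> lies below a member of it.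
\<close>

lemma (in continuous_dcpo) way_below_interpolation:
  assumes "way_below L a x"
  obtains b where "way_below L a b" "way_below L b x"
proof -
  note po = partial_order_axioms
  define B where "B = {b. \<exists>c. way_below L b c \<and> way_below L c x}"
  have x: "x \<in> carrier L" using assms by (rule way_below_carrier)
  have carrier: "b \<in> carrier L \<and> c \<in> carrier L" if "way_below L b c" for b c
    using way_below_carrier[OF that] by blast
  have common: "\<exists>e. way_below L e y \<and> c \<sqsubseteq> e \<and> d \<sqsubseteq> e" if "way_below L c y" "way_below L d y" for c d y
    using directed_in_common_upper_bound[OF way_below_directed[of y], of c d] that
    by (auto simp: carrier)
  have inhabited: "\<exists>c. way_below L c y" if "y \<in> carrier L" for y
    using way_below_directed[OF that] by (auto simp: directed_in_def)
  have dir: "directed_in L B"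
    unfolding directed_in_def
  proof (intro conjI ballI)
    show "B \<subseteq> carrier L" using carrier by (auto simp: B_def)
    show "B \<noteq> {}"
    proof -
      obtain c where c: "way_below L c x" using inhabited[OF x] by blast
      then obtain b where "way_below L b c" using inhabited[of c] carrier[OF c] by blast
      then show ?thesis using c by (auto simp: B_def)
    qed
    fix b b' assume "b \<in> B" "b' \<in> B"
    then obtain c c' where c: "way_below L b c" "way_below L c x" "way_below L b' c'" "way_below L c' x"
      by (auto simp: B_def)
    obtain e where e: "way_below L e x" "c \<sqsubseteq> e" "c' \<sqsubseteq> e" using common[OF c(2,4)] by blast
    have "way_below L b e" "way_below L b' e"
      using way_below_le_trans[OF po c(1) e(2)] way_below_le_trans[OF po c(3) e(3)] carrier[OF e(1)]
      by auto
    then obtain d where "way_below L d e" "b \<sqsubseteq> d" "b' \<sqsubseteq> d" using common by blast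
    then show "\<exists>z\<in>B. b \<sqsubseteq> z \<and> b' \<sqsubseteq> z" using e by (auto simp: B_def)
  qed
  have sup: "is_supremum L x B"
  proof (rule is_supremumI)
    show "B \<subseteq> carrier L" using carrier by (auto simp: B_def)
    show "b \<sqsubseteq> x" if b: "b \<in> B" for b
    proof -
      obtain c where "way_below L b c" "way_below L c x" using b by (auto simp: B_def)
      then show ?thesis
        using way_below_imp_le[OF po] carrier by (intro le_trans[of b c x]) auto
    qed
    fix u assume u: "u \<in> carrier L" "\<And>b. b \<in> B \<Longrightarrow> b \<sqsubseteq> u"
    have "c \<sqsubseteq> u" if c: "way_below L c x" for c
    proof (rule is_supremum_least[OF way_below_supremum u(1)])
      show "c \<in> carrier L" using carrier[OF c] by blast
      show "a \<sqsubseteq> u" if "a \<in> {a \<in> carrier L. way_below L a c}" for a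
        using that c by (intro u(2)) (auto simp: B_def)
    qed
    then show "x \<sqsubseteq> u"
      by (intro is_supremum_least[OF way_below_supremum[OF x] u(1)]) simp
  qed (rule x)
  obtain b where b: "b \<in> B" "a \<sqsubseteq> b"
    using way_belowD[OF assms dir sup le_refl[OF x]] by blast
  then obtain c where c: "way_below L b c" "way_below L c x" by (auto simp: B_def)
  have "way_below L a c"
    using le_way_below_trans[OF po b(2) c(1)] way_below_carrier(1)[OF assms] by blast
  then show thesis using c(2) by (rule that)
qed

section \<open>The algebraic domain of directed subsets\<close>

text \<open>
The injection \<open>\<iota>\<close> merely relabels the elements of \<open>D\<close>. It makes it possible to keep the directed subsets
in a type that is no larger than a given one.
\<close>

definition directed_subsets :: "('a \<Rightarrow> 'b) \<Rightarrow> ('a, 'c) gorder_scheme \<Rightarrow> 'b set gorder" where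
  "directed_subsets \<iota> D = \<lparr>carrier = {\<iota> ` A | A. directed_in D A}, eq = (=), le = (\<subseteq>)\<rparr>"

lemma directed_subsets_le [simp]: "A \<sqsubseteq>\<^bsub>directed_subsets \<iota> D\<^esub> B \<longleftrightarrow> A \<subseteq> B"
  by (simp add: directed_subsets_def)

lemma carrier_directed_subsets: "carrier (directed_subsets \<iota> D) = {\<iota> ` A | A. directed_in D A}"
  by (simp add: directed_subsets_def)

lemma partial_order_directed_subsets: "partial_order (directed_subsets \<iota> D)"
  by unfold_locales (auto simp: directed_subsets_def)

lemma inj_on_image_subset_iff:
  "inj_on f C \<Longrightarrow> A \<subseteq> C \<Longrightarrow> B \<subseteq> C \<Longrightarrow> f ` A \<subseteq> f ` B \<longleftrightarrow> A \<subseteq> B"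
  using inj_on_image_mem_iff[of f C _ B] unfolding image_subset_iff by blast

lemma is_supremum_Union:
  assumes inj: "inj_on \<iota> (carrier D)" and "directed_in (directed_subsets \<iota> D) \<A>"
  shows "is_supremum (directed_subsets \<iota> D) (\<Union>\<A>) \<A>"
proof (rule is_supremumI)
  show sub: "\<A> \<subseteq> carrier (directed_subsets \<iota> D)" using assms by (simp add: directed_in_def)
  define \<B> where "\<B> = {A. directed_in D A \<and> \<iota> ` A \<in> \<A>}"
  have \<A>: "\<A> = (`) \<iota> ` \<B>"
    using sub unfolding \<B>_def carrier_directed_subsets by blast
  have \<B>_sub: "A \<subseteq> carrier D" if "A \<in> \<B>" for A
    using that by (simp add: \<B>_def directed_in_def)
  have "directed_in D (\<Union>\<B>)"
    unfolding directed_in_def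
  proof (intro conjI ballI)
    show "\<Union>\<B> \<subseteq> carrier D" using \<B>_sub by blast
    obtain A where "A \<in> \<B>" using assms(2) unfolding \<A> directed_in_def by blast
    moreover have "A \<noteq> {}" using \<open>A \<in> \<B>\<close> by (simp add: \<B>_def directed_in_def)
    ultimately show "\<Union>\<B> \<noteq> {}" by blast
  next
    fix x y assume "x \<in> \<Union>\<B>" "y \<in> \<Union>\<B>"
    then obtain A A' where A: "A \<in> \<B>" "x \<in> A" "A' \<in> \<B>" "y \<in> A'" by blast
    then have "\<exists>C\<in>\<A>. \<iota> ` A \<subseteq> C \<and> \<iota> ` A' \<subseteq> C"
      using assms(2) unfolding directed_in_def directed_subsets_le \<A> by blast
    then obtain C where C: "C \<in> \<B>" "\<iota> ` A \<subseteq> \<iota> ` C" "\<iota> ` A' \<subseteq> \<iota> ` C"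
      unfolding \<A> by blast
    have "A \<subseteq> C" "A' \<subseteq> C"
      using C(2,3) inj_on_image_subset_iff[OF inj \<B>_sub[OF A(1)] \<B>_sub[OF C(1)]]
        inj_on_image_subset_iff[OF inj \<B>_sub[OF A(3)] \<B>_sub[OF C(1)]] by simp_all
    then have "x \<in> C" "y \<in> C" using A by blast+
    then obtain z where "z \<in> C" "x \<sqsubseteq>\<^bsub>D\<^esub> z" "y \<sqsubseteq>\<^bsub>D\<^esub> z"
      using C(1) unfolding \<B>_def directed_in_def by blast
    then show "\<exists>z\<in>\<Union>\<B>. x \<sqsubseteq>\<^bsub>D\<^esub> z \<and> y \<sqsubseteq>\<^bsub>D\<^esub> z" using C(1) by blast
  qed
  moreover have "\<Union>\<A> = \<iota> ` \<Union>\<B>" by (auto simp: \<A>)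
  ultimately show "\<Union>\<A> \<in> carrier (directed_subsets \<iota> D)"
    by (auto simp: carrier_directed_subsets)
qed (auto simp: carrier_directed_subsets)

lemma dcpo_directed_subsets:
  assumes "inj_on \<iota> (carrier D)"
  shows "dcpo (directed_subsets \<iota> D)"
proof -
  interpret partial_order "directed_subsets \<iota> D" by (rule partial_order_directed_subsets)
  show ?thesis by unfold_locales (use is_supremum_Union[OF assms] in blast)
qed

text \<open>
This is what makes the domain algebraic: adding an upper bound turns any finite part of a directed
set into a finite directed part.
\<close>

lemma finite_parts:
  fixes \<iota> :: "'a \<Rightarrow> 'b"
  assumes "partial_order D" and A: "directed_in D A"
  defines "\<F> \<equiv> {\<iota> ` F | F. F \<subseteq> A \<and> finite F \<and> directed_in D F}"
  shows "directed_in (directed_subsets \<iota> D) \<F>" and "\<Union>\<F> = \<iota> ` A"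
proof -
  interpret partial_order D by fact
  have A_carrier: "A \<subseteq> carrier D" using A by (simp add: directed_in_def)
  have extend: "\<exists>F'. F \<subseteq> F' \<and> F' \<subseteq> A \<and> finite F' \<and> directed_in D F'"
    if "F \<subseteq> A" "finite F" for F
  proof -
    have "\<exists>z\<in>A. \<forall>a\<in>F. a \<sqsubseteq>\<^bsub>D\<^esub> z"
      using directed_finite_upper_bound[OF assms(1) A] that by blast
    then obtain z where z: "z \<in> A" "\<forall>a\<in>F. a \<sqsubseteq>\<^bsub>D\<^esub> z" by blast
    have "directed_in D (insert z F)"
      unfolding directed_in_def using z that A_carrier by (auto intro!: bexI[of _ z])
    then show ?thesis using z that by (intro exI[of _ "insert z F"]) auto
  qed
  show "directed_in (directed_subsets \<iota> D) \<F>"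
    unfolding directed_in_def
  proof (intro conjI ballI)
    show "\<F> \<subseteq> carrier (directed_subsets \<iota> D)" by (auto simp: \<F>_def carrier_directed_subsets)
    show "\<F> \<noteq> {}" using extend[of "{}"] by (auto simp: \<F>_def)
    fix C C' assume "C \<in> \<F>" "C' \<in> \<F>"
    then obtain F F' where F: "C = \<iota> ` F" "F \<subseteq> A" "finite F" "C' = \<iota> ` F'" "F' \<subseteq> A" "finite F'"
      by (auto simp: \<F>_def)
    then obtain G where "F \<union> F' \<subseteq> G" "G \<subseteq> A" "finite G" "directed_in D G"
      using extend[of "F \<union> F'"] by auto
    then show "\<exists>E\<in>\<F>. C \<sqsubseteq>\<^bsub>directed_subsets \<iota> D\<^esub> E \<and> C' \<sqsubseteq>\<^bsub>directed_subsets \<iota> D\<^esub> E"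
      using F unfolding \<F>_def by (intro bexI[of _ "\<iota> ` G"]) auto
  qed
  show "\<Union>\<F> = \<iota> ` A"
  proof
    show "\<iota> ` A \<subseteq> \<Union>\<F>"
    proof
      fix b assume "b \<in> \<iota> ` A"
      then obtain a where "a \<in> A" "b = \<iota> a" by blast
      then show "b \<in> \<Union>\<F>" using extend[of "{a}"] by (auto simp: \<F>_def)
    qed
  qed (auto simp: \<F>_def)
qed

text \<open>
A compact directed set is contained in one of its finite directed parts. Conversely, a finite set
covered by a directed family of sets is covered by one member.
\<close>

lemma compact_directed_subset_iff:
  assumes "partial_order D" and inj: "inj_on \<iota> (carrier D)" and A: "directed_in D A"
  shows "compact_element (directed_subsets \<iota> D) (\<iota> ` A) \<longleftrightarrow> finite A"
proof
  let ?L = "directed_subsets \<iota> D"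
  interpret L: partial_order ?L by (rule partial_order_directed_subsets)
  have A_carrier: "A \<subseteq> carrier D" using A by (simp add: directed_in_def)
  note parts = finite_parts[OF assms(1) A, of \<iota>]
  {
    assume "compact_element ?L (\<iota> ` A)"
    from way_belowD[OF this parts(1) is_supremum_Union[OF inj parts(1)]]
    obtain C where "C \<in> {\<iota> ` F | F. F \<subseteq> A \<and> finite F \<and> directed_in D F}" "\<iota> ` A \<subseteq> C"
      unfolding parts(2) directed_subsets_le by blast
    then have "finite (\<iota> ` A)" using finite_subset by blast
    then show "finite A" using inj_on_subset[OF inj A_carrier] by (rule finite_imageD)
  next
    assume fin: "finite A"
    have "\<exists>C\<in>\<C>. \<iota> ` A \<subseteq> C"
      if \<C>: "directed_in ?L \<C>" "is_supremum ?L s \<C>" "\<iota> ` A \<subseteq> s" for \<C> s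
    proof -
      have "s = \<Union>\<C>" using \<C>(2) is_supremum_Union[OF inj \<C>(1)] by (rule L.is_supremum_unique)
      then have cover: "\<iota> ` A \<subseteq> \<Union>\<C>" using \<C>(3) by simp
      have "\<exists>C\<in>\<C>. B \<subseteq> C" if "B \<subseteq> \<iota> ` A" for B
        using finite_subset[OF that finite_imageI[OF fin]] that
      proof (induction B rule: finite_induct)
        case empty
        then show ?case using \<C>(1) by (auto simp: directed_in_def)
      next
        case (insert b B)
        then obtain C where C: "C \<in> \<C>" "B \<subseteq> C" by auto
        obtain C' where C': "C' \<in> \<C>" "b \<in> C'" using insert.prems cover by auto
        obtain E where "E \<in> \<C>" "C \<subseteq> E" "C' \<subseteq> E"
          using \<C>(1) C(1) C'(1) unfolding directed_in_def directed_subsets_le by blast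
        then show ?case using C C' by blast
      qed
      then show ?thesis by blast
    qed
    moreover have "\<iota> ` A \<in> carrier ?L" using A by (auto simp: carrier_directed_subsets)
    ultimately show "compact_element ?L (\<iota> ` A)"
      unfolding directed_subsets_le[symmetric, of _ _ \<iota> D] by (intro way_belowI) auto
  }
qed

theorem algebraic_domain_directed_subsets:
  assumes "partial_order D" and inj: "inj_on \<iota> (carrier D)"
  shows "algebraic_domain (directed_subsets \<iota> D)"
proof -
  let ?L = "directed_subsets \<iota> D"
  interpret dcpo ?L by (rule dcpo_directed_subsets[OF inj])
  have below: "directed_in ?L {k \<in> carrier ?L. compact_element ?L k \<and> k \<sqsubseteq>\<^bsub>?L\<^esub> x} \<and>
      is_supremum ?L x {k \<in> carrier ?L. compact_element ?L k \<and> k \<sqsubseteq>\<^bsub>?L\<^esub> x}"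
    if x: "x \<in> carrier ?L" for x
  proof -
    obtain A where A: "directed_in D A" "x = \<iota> ` A" using x by (auto simp: carrier_directed_subsets)
    have eq: "{k \<in> carrier ?L. compact_element ?L k \<and> k \<sqsubseteq>\<^bsub>?L\<^esub> x} =
        {\<iota> ` F | F. F \<subseteq> A \<and> finite F \<and> directed_in D F}" (is "?K = ?F")
    proof
      show "?K \<subseteq> ?F"
      proof
        fix k assume k: "k \<in> ?K"
        then obtain F where F: "directed_in D F" "k = \<iota> ` F" by (auto simp: carrier_directed_subsets)
        then have "finite F" using k compact_directed_subset_iff[OF assms F(1)] by simp
        moreover have "F \<subseteq> A"
          using k F A inj_on_image_subset_iff[OF inj, of F A] by (simp add: directed_in_def)
        ultimately show "k \<in> ?F" using F by blast
      qed
      show "?F \<subseteq> ?K"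
        using compact_directed_subset_iff[OF assms] A(2) by (auto simp: carrier_directed_subsets)
    qed
    note parts = finite_parts[OF assms(1) A(1), of \<iota>]
    show ?thesis
      unfolding eq using parts(1) is_supremum_Union[OF inj parts(1)]
      unfolding parts(2) A(2)[symmetric] by (rule conjI)
  qed
  show ?thesis by unfold_locales (use below in blast)+
qed

section \<open>Maps way below the map of approximants\<close>

text \<open>
For \<open>Q = {}\<close> this is the map into the directed subsets whose approximability is at stake. The other
instances, in which the elements of \<open>Q\<close> are withheld, approach it from below as \<open>Q\<close> shrinks.
\<close>

definition approximants :: "('a \<Rightarrow> 'b) \<Rightarrow> ('a, 'c) gorder_scheme \<Rightarrow> 'a set \<Rightarrow> 'a \<Rightarrow> 'b set" where
  "approximants \<iota> D Q = (\<lambda>x\<in>carrier D. \<iota> ` ({a. way_below D a x} - Q))"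

lemma approximants_eq: "x \<in> carrier D \<Longrightarrow> approximants \<iota> D Q x = \<iota> ` ({a. way_below D a x} - Q)"
  by (simp add: approximants_def)

lemma scott_function_space_carrierD:
  assumes "f \<in> carrier (scott_function_space D E)"
  shows "scott_continuous D E f" "x \<in> carrier D \<Longrightarrow> f x \<in> carrier E"
  using assms by (auto simp: scott_function_space_def PiE_def)

text \<open>
Continuity at a directed supremum is interpolation: what is way below the supremum is way below
a member of the directed set.
\<close>

lemma approximants_in_function_space:
  assumes "continuous_dcpo D" and inj: "inj_on \<iota> (carrier D)"
    and dir: "\<And>x. x \<in> carrier D \<Longrightarrow> directed_in D ({a. way_below D a x} - Q)"
  shows "approximants \<iota> D Q \<in> carrier (scott_function_space D (directed_subsets \<iota> D))"
proof -
  interpret D: continuous_dcpo D by fact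
  let ?L = "directed_subsets \<iota> D" and ?s = "approximants \<iota> D Q"
  interpret L: partial_order ?L by (rule partial_order_directed_subsets)
  note po = D.partial_order_axioms
  have mem: "?s x \<in> carrier ?L" if "x \<in> carrier D" for x
    using dir[OF that] by (auto simp: approximants_eq[OF that] carrier_directed_subsets)
  have mono: "?s x \<subseteq> ?s y" if x: "x \<in> carrier D" and y: "y \<in> carrier D" and "x \<sqsubseteq>\<^bsub>D\<^esub> y" for x y
    unfolding approximants_eq[OF x] approximants_eq[OF y]
    using way_below_le_trans[OF po _ \<open>x \<sqsubseteq>\<^bsub>D\<^esub> y\<close> y] by blast
  have "is_supremum ?L (?s y) (?s ` A)" if A: "directed_in D A" "is_supremum D y A" for A y
  proof -
    have y: "y \<in> carrier D" using A(2) by (rule is_supremum_carrier)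
    have A_carrier: "A \<subseteq> carrier D" using A(1) by (simp add: directed_in_def)
    have "b \<in> \<Union>(?s ` A)" if b: "b \<in> ?s y" for b
    proof -
      obtain a where a: "b = \<iota> a" "way_below D a y" "a \<notin> Q"
        using b by (auto simp: approximants_eq[OF y])
      obtain c where c: "way_below D a c" "way_below D c y"
        using D.way_below_interpolation[OF a(2)] .
      obtain z where z: "z \<in> A" "c \<sqsubseteq>\<^bsub>D\<^esub> z"
        using way_belowD[OF c(2) A D.le_refl[OF y]] by blast
      then have zD: "z \<in> carrier D" using A_carrier by blast
      have "b \<in> ?s z"
        using a way_below_le_trans[OF po c(1) z(2) zD] by (auto simp: approximants_eq[OF zD])
      then show ?thesis using z by blast
    qed
    then have cover: "?s y \<subseteq> \<Union>(?s ` A)" by blast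
    have upper: "?s a \<subseteq> ?s y" if "a \<in> A" for a
      using that A_carrier y is_supremum_upper[OF A(2) A_carrier that] by (intro mono) auto
    show ?thesis
    proof (rule is_supremumI)
      show "?s ` A \<subseteq> carrier ?L" "?s y \<in> carrier ?L" using A_carrier mem y by auto
      show "b \<sqsubseteq>\<^bsub>?L\<^esub> ?s y" if "b \<in> ?s ` A" for b using that upper by auto
      fix u assume "\<And>b. b \<in> ?s ` A \<Longrightarrow> b \<sqsubseteq>\<^bsub>?L\<^esub> u"
      then have "\<Union>(?s ` A) \<subseteq> u" unfolding directed_subsets_le by blast
      then show "?s y \<sqsubseteq>\<^bsub>?L\<^esub> u" using cover by simp
    qed
  qed
  then have "scott_continuous D ?L ?s"
    unfolding scott_continuous_def using mem mono
    by (auto intro!: isotoneI D.weak_partial_order_axioms L.weak_partial_order_axioms)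
  then show ?thesis
    using mem by (auto simp: scott_function_space_def approximants_def)
qed

lemma directed_in_chain:
  fixes f :: "nat \<Rightarrow> 'a"
  assumes "\<And>k. f k \<in> carrier D" "\<And>k l. k \<le> l \<Longrightarrow> f k \<sqsubseteq>\<^bsub>D\<^esub> f l"
  shows "directed_in D (range f)"
  unfolding directed_in_def
proof (intro conjI ballI)
  fix x y assume "x \<in> range f" "y \<in> range f"
  then obtain k l where "x = f k" "y = f l" by blast
  then show "\<exists>z\<in>range f. x \<sqsubseteq>\<^bsub>D\<^esub> z \<and> y \<sqsubseteq>\<^bsub>D\<^esub> z"
    using assms(2)[of k "max k l"] assms(2)[of l "max k l"] by auto
qed (use assms(1) in auto)

text \<open>
Given infinitely many non-compact elements \<open>q\<^sub>0, q\<^sub>1, \<dots>\<close> that occur in values of \<open>h\<close>, withhold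
\<open>q\<^sub>k, q\<^sub>k\<^sub>+\<^sub>1, \<dots>\<close>. As \<open>k\<close> grows these maps increase to the full map of approximants, so one of them
is above \<open>h\<close>; yet it misses \<open>q\<^sub>k\<close>.
\<close>

theorem finite_values_of_way_below_approximants:
  assumes "continuous_dcpo D" and inj: "inj_on \<iota> (carrier D)"
    and dir: "\<And>x Q. \<lbrakk>x \<in> carrier D; countable Q; \<And>a. a \<in> Q \<Longrightarrow> \<not> compact_element D a\<rbrakk>
                \<Longrightarrow> directed_in D ({a. way_below D a x} - Q)"
    and h: "way_below (scott_function_space D (directed_subsets \<iota> D)) h (approximants \<iota> D {})"
  shows "finite {a \<in> carrier D. \<not> compact_element D a \<and> (\<exists>x\<in>carrier D. \<iota> a \<in> h x)}" (is "finite ?H")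
proof (rule ccontr)
  assume "infinite ?H"
  then obtain q :: "nat \<Rightarrow> 'a" where q: "inj q" "range q \<subseteq> ?H"
    using infinite_countable_subset by blast
  let ?L = "directed_subsets \<iota> D"
  let ?F = "scott_function_space D ?L"
  interpret D: continuous_dcpo D by fact
  define s where "s k = approximants \<iota> D (q ` {k..})" for k
  have s_mem: "s k \<in> carrier ?F" for k
    unfolding s_def
    by (intro approximants_in_function_space assms(1) inj dir) (use q(2) in auto)
  have s_eq: "s k x = \<iota> ` ({a. way_below D a x} - q ` {k..})" if "x \<in> carrier D" for k x
    using that by (simp add: s_def approximants_eq)
  have s_mono: "s k \<sqsubseteq>\<^bsub>?F\<^esub> s l" if kl: "k \<le> l" for k l
  proof -
    have "s k x \<subseteq> s l x" if "x \<in> carrier D" for x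
      unfolding s_eq[OF that] using kl by (intro image_mono Diff_mono) auto
    then show ?thesis by (simp add: scott_function_space_def)
  qed
  have chain: "directed_in ?F (range s)" using s_mem s_mono by (rule directed_in_chain)
  have union: "\<Union>((\<lambda>f. f x) ` range s) = approximants \<iota> D {} x" if x: "x \<in> carrier D" for x
  proof
    show "approximants \<iota> D {} x \<subseteq> \<Union>((\<lambda>f. f x) ` range s)"
    proof
      fix b assume "b \<in> approximants \<iota> D {} x"
      then obtain a where a: "b = \<iota> a" "way_below D a x" by (auto simp: approximants_eq[OF x])
      obtain k where "a \<notin> q ` {k..}"
      proof (cases "a \<in> range q")
        case True
        then obtain k where "a = q k" by blast
        then have "a \<notin> q ` {Suc k..}" using q(1) by (auto dest: injD)
        then show ?thesis by (rule that)
      qed (use that[of 0] in auto)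
      then have "b \<in> s k x" using a by (simp add: s_eq[OF x])
      then show "b \<in> \<Union>((\<lambda>f. f x) ` range s)" by blast
    qed
  qed (auto simp: s_eq[OF x] approximants_eq[OF x])
  have "is_supremum ?F (approximants \<iota> D {}) (range s)"
  proof (rule is_supremum_scott_function_space[OF D.dcpo_axioms dcpo_directed_subsets[OF inj] chain])
    show "approximants \<iota> D {} \<in> extensional (carrier D)" by (simp add: approximants_def)
    fix x assume x: "x \<in> carrier D"
    show "is_supremum ?L (approximants \<iota> D {} x) ((\<lambda>f. f x) ` range s)"
      using is_supremum_Union[OF inj directed_in_eval[OF chain x]] unfolding union[OF x] .
  qed
  moreover have "approximants \<iota> D {} \<sqsubseteq>\<^bsub>?F\<^esub> approximants \<iota> D {}"
    by (auto simp: scott_function_space_def)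
  ultimately obtain k where k: "h \<sqsubseteq>\<^bsub>?F\<^esub> s k"
    using way_belowD[OF h chain] by blast
  obtain x where x: "x \<in> carrier D" "\<iota> (q k) \<in> h x" using q(2) by blast
  then have "\<iota> (q k) \<in> s k x" using k by (auto simp: scott_function_space_def)
  then obtain a where a: "\<iota> (q k) = \<iota> a" "way_below D a x" "a \<notin> q ` {k..}"
    by (auto simp: s_eq[OF x(1)])
  have "q k = a"
    using inj a(1) q(2) way_below_carrier(1)[OF a(2)] by (auto dest: inj_onD)
  then show False using a(3) by auto
qed

text \<open>
Suprema in the function space are pointwise unions. So if the maps way below the map of approximants
have it as their supremum, each single relation \<open>a \<lless> x\<close> is witnessed by one of them, and
directedness combines finitely many witnesses.
\<close>

lemma ex_way_below_approximant:
  assumes "continuous_dcpo D" and inj: "inj_on \<iota> (carrier D)"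
    and base: "approximants \<iota> D {} \<in> carrier (scott_function_space D (directed_subsets \<iota> D))"
    and cont: "continuous_dcpo (scott_function_space D (directed_subsets \<iota> D))"
    and "finite K" and K: "\<And>a x. (a, x) \<in> K \<Longrightarrow> way_below D a x"
  shows "\<exists>h. way_below (scott_function_space D (directed_subsets \<iota> D)) h (approximants \<iota> D {}) \<and>
             (\<forall>(a, x)\<in>K. \<iota> a \<in> h x)"
proof -
  let ?L = "directed_subsets \<iota> D"
  let ?F = "scott_function_space D ?L" and ?s = "approximants \<iota> D {}"
  interpret D: continuous_dcpo D by fact
  interpret F: continuous_dcpo ?F by fact
  define H where "H = {h \<in> carrier ?F. way_below ?F h ?s}"
  have H: "directed_in ?F H" "is_supremum ?F ?s H"
    using F.way_below_directed[OF base] F.way_below_supremum[OF base] by (simp_all add: H_def)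
  have H_ne: "H \<noteq> {}" using H(1) by (simp add: directed_in_def)
  define g where "g = (\<lambda>x\<in>carrier D. \<Union>((\<lambda>f. f x) ` H))"
  have "is_supremum ?F g H"
  proof (rule is_supremum_scott_function_space[OF D.dcpo_axioms dcpo_directed_subsets[OF inj] H(1)])
    show "g \<in> extensional (carrier D)" by (simp add: g_def)
    fix x assume x: "x \<in> carrier D"
    show "is_supremum ?L (g x) ((\<lambda>f. f x) ` H)"
      using is_supremum_Union[OF inj directed_in_eval[OF H(1) x]] x by (simp add: g_def)
  qed
  then have "g = ?s" using H(2) by (rule F.is_supremum_unique)
  have one: "\<exists>h\<in>H. \<iota> a \<in> h x" if "way_below D a x" for a x
  proof -
    have x: "x \<in> carrier D" using that by (rule way_below_carrier)
    have "\<iota> a \<in> g x" using that unfolding \<open>g = ?s\<close> approximants_eq[OF x] by blast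
    then show ?thesis using x by (auto simp: g_def)
  qed
  have "\<exists>h\<in>H. \<forall>(a, x)\<in>K. \<iota> a \<in> h x"
    using \<open>finite K\<close> K
  proof (induction K rule: finite_induct)
    case empty
    then show ?case using H_ne by auto
  next
    case (insert p K)
    obtain a x where p: "p = (a, x)" by (cases p)
    have ax: "way_below D a x" using insert.prems p by blast
    obtain h where h: "h \<in> H" "\<forall>(a, x)\<in>K. \<iota> a \<in> h x" using insert by blast
    obtain h' where h': "h' \<in> H" "\<iota> a \<in> h' x" using one[OF ax] by blast
    obtain k where k: "k \<in> H" "h \<sqsubseteq>\<^bsub>?F\<^esub> k" "h' \<sqsubseteq>\<^bsub>?F\<^esub> k"
      using directed_in_common_upper_bound[OF H(1) h(1) h'(1)] by blast
    have le: "h y \<subseteq> k y" "h' y \<subseteq> k y" if "y \<in> carrier D" for y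
      using k(2,3) that by (simp_all add: scott_function_space_def)
    have "\<iota> b \<in> k y" if "(b, y) \<in> insert p K" for b y
    proof (cases "(b, y) = p")
      case True
      then show ?thesis using h'(2) le(2)[OF way_below_carrier(2)[OF ax]] p by auto
    next
      case False
      then have "(b, y) \<in> K" using that by simp
      moreover have "y \<in> carrier D" using insert.prems[OF that] by (rule way_below_carrier)
      ultimately show ?thesis using h(2) le(1) by blast
    qed
    then show ?case using k(1) by blast
  qed
  then show ?thesis by (auto simp: H_def)
qed

section \<open>The jump inequality\<close>

lemma sum_shift_difference:
  fixes f :: "nat \<Rightarrow> real"
  shows "(\<Sum>i<n. f (i + s) - f i) = (\<Sum>i<s. f (n + i) - f i)"
proof (induction s)
  case (Suc s)
  have "(\<Sum>i<n. f (i + Suc s) - f i) =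
      (\<Sum>i<n. f (i + s) - f i) + (\<Sum>i<n. f (Suc i + s) - f (i + s))"
    by (simp flip: sum.distrib)
  also have "(\<Sum>i<n. f (Suc i + s) - f (i + s)) = f (n + s) - f s"
    using sum_lessThan_telescope[of "\<lambda>i. f (i + s)" n] by simp
  finally show ?case using Suc by simp
qed simp

text \<open>
The index \<open>k\<close> numbers the values \<open>(X k, Y k, T k)\<close> of a map in the order in which they can be
attained along one vertical line; \<open>\<alpha> k\<close> and \<open>\<beta> k\<close> say how far the surface below the \<open>k\<close>-th value
is displaced when one moves by a step \<open>s\<close> in either space direction. The set \<open>B\<close> contains the values that are
held for a substantial time. The surfaces between two consecutive members of \<open>B\<close> are displaced by almost
the same amount, so they act as one surface across which the value jumps from one member of \<open>B\<close> to
the next; that jump is bounded by its time component. The term with \<open>e\<close> collects the deviations.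
\<close>

lemma jump_inequality:
  fixes X Y T \<alpha> \<beta> :: "nat \<Rightarrow> real" and D e R s :: real
  assumes bound: "\<And>k. k < N \<Longrightarrow> \<bar>X k\<bar> \<le> D \<and> \<bar>Y k\<bar> \<le> D"
    and \<alpha>s: "\<And>k. k \<le> N \<Longrightarrow> \<bar>\<alpha> k\<bar> \<le> s" and \<beta>s: "\<And>k. k \<le> N \<Longrightarrow> \<bar>\<beta> k\<bar> \<le> s"
    and ends: "\<alpha> 0 = 0" "\<alpha> N = 0" "\<beta> 0 = 0" "\<beta> N = 0"
    and small: "\<And>k. k < N \<Longrightarrow> k \<notin> B \<Longrightarrow> \<bar>\<alpha> k - \<alpha> (Suc k)\<bar> \<le> e \<and> \<bar>\<beta> k - \<beta> (Suc k)\<bar> \<le> e"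
    and order: "\<And>a b. a \<in> B \<Longrightarrow> b \<in> B \<Longrightarrow> a < b \<Longrightarrow> b < N \<Longrightarrow>
                  \<bar>X b - X a\<bar> + \<bar>Y b - Y a\<bar> \<le> T b - T a"
    and range: "\<And>a b. a \<in> B \<Longrightarrow> b \<in> B \<Longrightarrow> a < b \<Longrightarrow> b < N \<Longrightarrow> T b - T a \<le> R"
    and nonneg: "0 \<le> D" "0 \<le> e" "0 \<le> R" "0 \<le> s"
  shows "(\<Sum>k<N. X k * (\<alpha> k - \<alpha> (Suc k)) + Y k * (\<beta> k - \<beta> (Suc k))) \<le> s * R + 4 * real N * D * e"
proof -
  define S where "S n = (\<Sum>k<n. X k * (\<alpha> k - \<alpha> (Suc k)) + Y k * (\<beta> k - \<beta> (Suc k)))" for n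
  have prod_le: "x * y \<le> c * d" if "\<bar>x\<bar> \<le> c" "\<bar>y\<bar> \<le> d" for x y c d :: real
  proof -
    have "x * y \<le> \<bar>x\<bar> * \<bar>y\<bar>" by (metis abs_ge_self abs_mult)
    also have "\<dots> \<le> c * d" using that by (intro mult_mono) auto
    finally show ?thesis .
  qed
  \<comment> \<open>Summation up to \<open>n\<close>, before and after the first member of \<open>B\<close>. In the second case \<open>a\<close> is
    the first and \<open>b\<close> the last member so far, and the terms in \<open>b\<close> record the unfinished jump from \<open>b\<close>.\<close>
  define none where "none n \<longleftrightarrow>
      S n \<le> 2 * real n * D * e \<and> \<bar>\<alpha> n\<bar> \<le> n * e \<and> \<bar>\<beta> n\<bar> \<le> n * e \<and> (\<forall>i<n. i \<notin> B)" for n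
  define some where "some n \<longleftrightarrow> (\<exists>a b. a \<in> B \<and> b \<in> B \<and> a \<le> b \<and> b < n \<and>
      S n \<le> s * (T b - T a) - X b * \<alpha> n - Y b * \<beta> n + 4 * real n * D * e)" for n
  have step: "none n \<or> some n" if "n \<le> N" for n
    using that
  proof (induction n)
    case 0
    show ?case by (simp add: none_def S_def ends)
  next
    case (Suc n)
    then have n: "n < N" and IH: "none n \<or> some n" by auto
    have S_Suc: "S (Suc n) = S n + (X n * (\<alpha> n - \<alpha> (Suc n)) + Y n * (\<beta> n - \<beta> (Suc n)))"
      by (simp add: S_def)
    note bn = bound[OF n]
    show ?case
    proof (cases "n \<in> B")
      case nB: True
      from IH have "some (Suc n)"
      proof
        assume 0: "none n"
        have "X n * \<alpha> n \<le> D * (n * e)" "Y n * \<beta> n \<le> D * (n * e)"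
          using 0 bn by (auto simp: none_def intro!: prod_le)
        moreover have "4 * real n * D * e \<le> 4 * real (Suc n) * D * e"
          using nonneg by (intro mult_right_mono) auto
        ultimately have "S (Suc n) \<le> s * (T n - T n) - X n * \<alpha> (Suc n) - Y n * \<beta> (Suc n) + 4 * real (Suc n) * D * e"
          using 0 unfolding none_def S_Suc by (simp add: algebra_simps)
        then show ?thesis unfolding some_def using nB by blast
      next
        assume "some n"
        then obtain a b where ab: "a \<in> B" "b \<in> B" "a \<le> b" "b < n"
          and le: "S n \<le> s * (T b - T a) - X b * \<alpha> n - Y b * \<beta> n + 4 * real n * D * e"
          by (auto simp: some_def)
        have "(X n - X b) * \<alpha> n + (Y n - Y b) * \<beta> n \<le> \<bar>X n - X b\<bar> * s + \<bar>Y n - Y b\<bar> * s"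
          using \<alpha>s[of n] \<beta>s[of n] n by (intro add_mono prod_le) auto
        also have "\<dots> = s * (\<bar>X n - X b\<bar> + \<bar>Y n - Y b\<bar>)" by (simp add: algebra_simps)
        also have "\<dots> \<le> s * (T n - T b)"
          using order[OF ab(2) nB ab(4) n] nonneg by (intro mult_left_mono) auto
        finally have "(X n - X b) * \<alpha> n + (Y n - Y b) * \<beta> n \<le> s * (T n - T b)" .
        moreover have "4 * real n * D * e \<le> 4 * real (Suc n) * D * e"
          using nonneg by (intro mult_right_mono) auto
        ultimately have "S (Suc n) \<le> s * (T n - T a) - X n * \<alpha> (Suc n) - Y n * \<beta> (Suc n) + 4 * real (Suc n) * D * e"
          using le unfolding S_Suc by (simp add: algebra_simps)
        then show ?thesis unfolding some_def using nB ab by (intro exI[of _ a] exI[of _ n]) auto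
      qed
      then show ?thesis ..
    next
      case nB: False
      note sm = small[OF n nB]
      from IH show ?thesis
      proof
        assume 0: "none n"
        have "X n * (\<alpha> n - \<alpha> (Suc n)) \<le> D * e" "Y n * (\<beta> n - \<beta> (Suc n)) \<le> D * e"
          using sm bn by (auto intro!: prod_le)
        then have "none (Suc n)"
          using 0 sm nB unfolding none_def S_Suc
          by (auto simp: algebra_simps less_Suc_eq abs_if split: if_splits)
        then show ?thesis ..
      next
        assume "some n"
        then obtain a b where ab: "a \<in> B" "b \<in> B" "a \<le> b" "b < n"
          and le: "S n \<le> s * (T b - T a) - X b * \<alpha> n - Y b * \<beta> n + 4 * real n * D * e"
          by (auto simp: some_def)
        have "\<bar>X n - X b\<bar> \<le> 2 * D" "\<bar>Y n - Y b\<bar> \<le> 2 * D"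
          using bn bound[of b] ab n by auto
        then have "(X n - X b) * (\<alpha> n - \<alpha> (Suc n)) \<le> 2 * D * e"
          "(Y n - Y b) * (\<beta> n - \<beta> (Suc n)) \<le> 2 * D * e"
          using sm by (auto intro!: prod_le)
        then have "S (Suc n) \<le> s * (T b - T a) - X b * \<alpha> (Suc n) - Y b * \<beta> (Suc n) + 4 * real (Suc n) * D * e"
          using le unfolding S_Suc by (simp add: algebra_simps)
        then have "some (Suc n)"
          unfolding some_def using ab by (intro exI[of _ a] exI[of _ b]) auto
        then show ?thesis ..
      qed
    qed
  qed
  have De: "0 \<le> N * D * e" using nonneg by simp
  have "0 \<le> s * R" using nonneg by simp
  from step[of N] have "S N \<le> s * R + 4 * real N * D * e"
  proof
    assume "none N"
    then show ?thesis using De \<open>0 \<le> s * R\<close> by (simp add: none_def)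
  next
    assume "some N"
    then obtain a b where ab: "a \<in> B" "b \<in> B" "a \<le> b" "b < N"
      and le: "S N \<le> s * (T b - T a) + 4 * real N * D * e"
      by (auto simp: some_def ends)
    have "T b - T a \<le> R" using ab range[of a b] nonneg by (cases "a = b") auto
    then have "s * (T b - T a) \<le> s * R" using nonneg by (intro mult_left_mono) auto
    then show ?thesis using le by simp
  qed simp
  then show ?thesis by (simp add: S_def)
qed

section \<open>Finite-valued monotone maps on a grid\<close>

text \<open>
The values of a finite-valued monotone map on the grid of events \<open>(i / n, j / n, t / n)\<close>: the value
at such an event has index \<open>\<kappa> i j t\<close> and coordinates \<open>X\<close>, \<open>Y\<close>, \<open>T\<close>. Indices are assumed to respect the
order of events, so that each vertical line passes through them in increasing order. The grid is twice as wide as it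
is high in order to leave room for shifts by up to \<open>n\<close>.
\<close>

locale quantised_grid =
  fixes n N :: nat and \<kappa> :: "nat \<Rightarrow> nat \<Rightarrow> nat \<Rightarrow> nat" and X Y T :: "nat \<Rightarrow> real"
  assumes n_pos: "0 < n"
    and index: "\<And>i j t. i < 2 * n \<Longrightarrow> j < 2 * n \<Longrightarrow> t < n \<Longrightarrow> \<kappa> i j t < N"
    and monotone: "\<And>i j t i' j' t'.
      \<lbrakk>i < 2 * n; j < 2 * n; t < n; i' < 2 * n; j' < 2 * n; t' < n;
       \<bar>int i' - int i\<bar> + \<bar>int j' - int j\<bar> \<le> int t' - int t\<rbrakk> \<Longrightarrow>
       \<kappa> i j t \<le> \<kappa> i' j' t' \<and>
       \<bar>X (\<kappa> i' j' t') - X (\<kappa> i j t)\<bar> + \<bar>Y (\<kappa> i' j' t') - Y (\<kappa> i j t)\<bar>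
         \<le> T (\<kappa> i' j' t') - T (\<kappa> i j t)"
    and near: "\<And>i j t. \<lbrakk>i < 2 * n; j < 2 * n; t < n\<rbrakk> \<Longrightarrow>
       \<bar>X (\<kappa> i j t) - i / n\<bar> \<le> 1 / 12 \<and> \<bar>Y (\<kappa> i j t) - j / n\<bar> \<le> 1 / 12 \<and>
       t / n - 1 / 12 \<le> T (\<kappa> i j t) \<and> T (\<kappa> i j t) \<le> t / n"
    and bounded: "\<And>k. k < N \<Longrightarrow> \<bar>X k\<bar> \<le> 3 \<and> \<bar>Y k\<bar> \<le> 3"
begin

text \<open>
Along a vertical line the index increases, so \<open>below i j k\<close> is the time at which the line crosses the
\<open>k\<close>-th surface, and \<open>level i j k\<close> is the time that it spends at the value \<open>k\<close>.
\<close>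

definition below :: "nat \<Rightarrow> nat \<Rightarrow> nat \<Rightarrow> nat" where
  "below i j k = card {t. t < n \<and> \<kappa> i j t < k}"

definition level :: "nat \<Rightarrow> nat \<Rightarrow> nat \<Rightarrow> nat" where
  "level i j k = card {t. t < n \<and> \<kappa> i j t = k}"

lemma below_0 [simp]: "below i j 0 = 0"
  by (simp add: below_def)

lemma below_N: "i < 2 * n \<Longrightarrow> j < 2 * n \<Longrightarrow> below i j N = n"
  using index by (simp add: below_def cong: conj_cong)

lemma below_Suc: "below i j (Suc k) = below i j k + level i j k"
proof -
  have "{t. t < n \<and> \<kappa> i j t < Suc k} = {t. t < n \<and> \<kappa> i j t < k} \<union> {t. t < n \<and> \<kappa> i j t = k}"
    by auto
  then show ?thesis
    unfolding below_def level_def by (simp only:) (subst card_Un_disjoint; auto)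
qed

lemma column_sum:
  fixes f :: "nat \<Rightarrow> real"
  assumes "i < 2 * n" "j < 2 * n"
  shows "(\<Sum>t<n. f (\<kappa> i j t)) = (\<Sum>k<N. f k * level i j k)"
proof -
  have "(\<Sum>t<n. f (\<kappa> i j t)) = (\<Sum>k<N. \<Sum>t\<in>{t. t \<in> {..<n} \<and> \<kappa> i j t = k}. f (\<kappa> i j t))"
    by (rule sum.group[symmetric]) (use index assms in auto)
  also have "\<dots> = (\<Sum>k<N. f k * level i j k)"
    by (intro sum.cong) (simp_all add: level_def mult.commute)
  finally show ?thesis .
qed

text \<open>
The surfaces are Lipschitz with constant \<open>1\<close>: an event that precedes another one
has no larger index.
\<close>

lemma below_le_below_add:
  assumes "i < 2 * n" "j < 2 * n" "i' < 2 * n" "j' < 2 * n"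
    and "\<bar>int i' - int i\<bar> + \<bar>int j' - int j\<bar> \<le> int s"
  shows "below i' j' k \<le> below i j k + s"
proof -
  have "{t. t < n \<and> \<kappa> i' j' t < k} \<subseteq> {..<s} \<union> (\<lambda>t. t + s) ` {t. t < n \<and> \<kappa> i j t < k}"
  proof
    fix t assume t: "t \<in> {t. t < n \<and> \<kappa> i' j' t < k}"
    show "t \<in> {..<s} \<union> (\<lambda>t. t + s) ` {t. t < n \<and> \<kappa> i j t < k}"
    proof (cases "t < s")
      case False
      then have "\<kappa> i j (t - s) \<le> \<kappa> i' j' t"
        using monotone[of i j "t - s" i' j' t] t assms by auto
      then have "t - s \<in> {t. t < n \<and> \<kappa> i j t < k}" using t by auto
      moreover have "t = t - s + s" using False by simp
      ultimately show ?thesis by blast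
    qed simp
  qed
  then have "below i' j' k \<le> card ({..<s} \<union> (\<lambda>t. t + s) ` {t. t < n \<and> \<kappa> i j t < k})"
    unfolding below_def by (intro card_mono) auto
  also have "\<dots> \<le> card {..<s} + card ((\<lambda>t. t + s) ` {t. t < n \<and> \<kappa> i j t < k})"
    by (rule card_Un_le)
  also have "\<dots> = below i j k + s"
    by (simp add: below_def card_image)
  finally show ?thesis .
qed

lemma below_lipschitz:
  assumes "i < 2 * n" "j < 2 * n" "i' < 2 * n" "j' < 2 * n"
    and "\<bar>int i' - int i\<bar> + \<bar>int j' - int j\<bar> \<le> int s"
  shows "\<bar>real (below i j k) - real (below i' j' k)\<bar> \<le> s"
proof -
  have "below i' j' k \<le> below i j k + s" "below i j k \<le> below i' j' k + s"
    using assms by (auto intro!: below_le_below_add simp: abs_minus_commute)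
  then show ?thesis by linarith
qed

lemma level_lipschitz:
  assumes "i < 2 * n" "j < 2 * n" "i' < 2 * n" "j' < 2 * n"
    and "\<bar>int i' - int i\<bar> + \<bar>int j' - int j\<bar> \<le> int s"
  shows "level i' j' k \<le> level i j k + 2 * s"
proof -
  have "below i' j' (Suc k) \<le> below i j (Suc k) + s" "below i j k \<le> below i' j' k + s"
    using assms by (auto intro!: below_le_below_add simp: abs_minus_commute)
  then show ?thesis unfolding below_Suc by linarith
qed

text \<open>
The discrete counterpart of \<open>\<partial>X/\<partial>x + \<partial>Y/\<partial>y\<close>, summed over a vertical line.
\<close>

definition gain :: "nat \<Rightarrow> nat \<Rightarrow> nat \<Rightarrow> real" where
  "gain s i j = (\<Sum>t<n. (X (\<kappa> (i + s) j t) - X (\<kappa> i j t)) + (Y (\<kappa> i (j + s) t) - Y (\<kappa> i j t)))"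

definition descent :: "nat \<Rightarrow> nat \<Rightarrow> nat \<Rightarrow> nat \<Rightarrow> nat \<Rightarrow> real" where
  "descent i j i' j' k = real (below i j k) - real (below i' j' k)"

lemma descent_diff:
  "descent i j i' j' k - descent i j i' j' (Suc k) = real (level i' j' k) - real (level i j k)"
  by (simp add: descent_def below_Suc)

lemma gain_eq:
  assumes "i < n" "j < n" "s \<le> n"
  shows "gain s i j =
    (\<Sum>k<N. X k * (descent i j (i + s) j k - descent i j (i + s) j (Suc k)) +
           Y k * (descent i j i (j + s) k - descent i j i (j + s) (Suc k)))"
  using assms unfolding gain_def descent_diff
  by (simp add: sum.distrib sum_subtractf column_sum algebra_simps)

lemma gain_le:
  assumes "i < n" "j < n" "s \<le> n"
  shows "gain s i j \<le> 12 * N * s"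
proof -
  have le: "X k * (descent i j (i + s) j k - descent i j (i + s) j (Suc k)) +
           Y k * (descent i j i (j + s) k - descent i j i (j + s) (Suc k)) \<le> 12 * s" if k: "k < N" for k
  proof -
    have "\<bar>descent i j (i + s) j k - descent i j (i + s) j (Suc k)\<bar> \<le> 2 * real s"
      "\<bar>descent i j i (j + s) k - descent i j i (j + s) (Suc k)\<bar> \<le> 2 * real s"
      using below_lipschitz[of i j "i + s" j s k] below_lipschitz[of i j "i + s" j s "Suc k"]
        below_lipschitz[of i j i "j + s" s k] below_lipschitz[of i j i "j + s" s "Suc k"] assms
      unfolding descent_def by auto
    then have "\<bar>X k * (descent i j (i + s) j k - descent i j (i + s) j (Suc k))\<bar> \<le> 3 * (2 * real s)"
      "\<bar>Y k * (descent i j i (j + s) k - descent i j i (j + s) (Suc k))\<bar> \<le> 3 * (2 * real s)"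
      using bounded[OF k] unfolding abs_mult by - (rule mult_mono; simp)+
    then show ?thesis by linarith
  qed
  have "gain s i j \<le> (\<Sum>k<N. 12 * real s)"
    unfolding gain_eq[OF assms] by (rule sum_mono) (use le in auto)
  then show ?thesis by simp
qed

text \<open>
At these lines two consecutive surfaces are neither practically coincident (distance at most \<open>a\<close>) nor
well apart (distance more than \<open>b\<close>).
\<close>

definition exceptional :: "nat \<Rightarrow> nat \<Rightarrow> (nat \<times> nat) set" where
  "exceptional a b = {(i, j). i < 2 * n \<and> j < 2 * n \<and> (\<exists>k<N. a < level i j k \<and> level i j k \<le> b)}"

text \<open>
If a value is held for at most \<open>a\<close> on the original line, then it is held for at most
\<open>a + 2 s \<le> b\<close> on the shifted line, hence for at most \<open>a\<close>, that line being unexceptional. So the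
two surfaces around such a value are displaced by nearly the same amount, as the jump inequality requires.
\<close>

lemma gain_le_unexceptional:
  assumes ij: "i < n" "j < n" and s: "s \<le> n" and "a + 2 * s \<le> b"
    and E: "(i + s, j) \<notin> exceptional a b" "(i, j + s) \<notin> exceptional a b"
  shows "gain s i j \<le> s * (13 / 12) + 12 * N * a"
proof -
  define B where "B = {k. a < level i j k}"
  have attained: "\<exists>t<n. \<kappa> i j t = k" if "k \<in> B" for k
  proof (rule ccontr)
    assume "\<not> ?thesis"
    then have "{t. t < n \<and> \<kappa> i j t = k} = {}" by auto
    then have "level i j k = 0" unfolding level_def by (metis card.empty)
    then show False using that by (simp add: B_def)
  qed
  have ordered: "\<exists>t t'. t \<le> t' \<and> t < n \<and> t' < n \<and> \<kappa> i j t = k \<and> \<kappa> i j t' = l"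
    if "k \<in> B" "l \<in> B" "k < l" for k l
  proof -
    obtain t t' where t: "t < n" "\<kappa> i j t = k" "t' < n" "\<kappa> i j t' = l"
      using attained \<open>k \<in> B\<close> \<open>l \<in> B\<close> by blast
    have "t \<le> t'"
      using monotone[of i j t' i j t] t ij \<open>k < l\<close> by linarith
    then show ?thesis using t by blast
  qed
  have small_level: "level i' j' k \<le> a"
    if "k < N" "k \<notin> B" "i' < 2 * n" "j' < 2 * n" "\<bar>int i' - int i\<bar> + \<bar>int j' - int j\<bar> \<le> int s"
      "(i', j') \<notin> exceptional a b" for i' j' k
  proof -
    have "level i' j' k \<le> b"
      using level_lipschitz[of i j i' j' s k] that ij \<open>a + 2 * s \<le> b\<close> by (simp add: B_def)
    then have "(i', j') \<in> exceptional a b" if "a < level i' j' k"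
      using that \<open>k < N\<close> \<open>i' < 2 * n\<close> \<open>j' < 2 * n\<close> by (auto simp: exceptional_def)
    then show ?thesis using \<open>(i', j') \<notin> exceptional a b\<close> not_less by blast
  qed
  have "gain s i j \<le> s * (13 / 12) + 4 * real N * 3 * a"
    unfolding gain_eq[OF ij s]
  proof (rule jump_inequality[where B = B and T = T])
    show "\<bar>X k\<bar> \<le> 3 \<and> \<bar>Y k\<bar> \<le> 3" if "k < N" for k using bounded that by blast
    show "\<bar>descent i j (i + s) j k\<bar> \<le> s" "\<bar>descent i j i (j + s) k\<bar> \<le> s" for k
      unfolding descent_def using ij s by (auto intro!: below_lipschitz)
    show "descent i j (i + s) j 0 = 0" "descent i j i (j + s) 0 = 0"
      "descent i j (i + s) j N = 0" "descent i j i (j + s) N = 0"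
      using ij s by (simp_all add: descent_def below_N)
    show "\<bar>descent i j (i + s) j k - descent i j (i + s) j (Suc k)\<bar> \<le> a \<and>
          \<bar>descent i j i (j + s) k - descent i j i (j + s) (Suc k)\<bar> \<le> a" if "k < N" "k \<notin> B" for k
      using small_level[OF that, of "i + s" j] small_level[OF that, of i "j + s"] that ij s E
      unfolding descent_diff by (auto simp: B_def)
    show "\<bar>X l - X k\<bar> + \<bar>Y l - Y k\<bar> \<le> T l - T k" if "k \<in> B" "l \<in> B" "k < l" for k l
      using ordered[OF that] monotone ij by fastforce
    show "T l - T k \<le> 13 / 12" if kl: "k \<in> B" "l \<in> B" "k < l" for k l
    proof -
      obtain t t' where t: "t < n" "\<kappa> i j t = k" "t' < n" "\<kappa> i j t' = l"
        using ordered[OF kl] by blast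
      have "T l \<le> t' / n" "t / n - 1 / 12 \<le> T k"
        using near[of i j t] near[of i j t'] t ij by auto
      moreover have "t' / n \<le> 1" "0 \<le> t / n" using t by auto
      ultimately show ?thesis by linarith
    qed
  qed auto
  then show ?thesis by simp
qed

text \<open>
The sum telescopes to differences across the whole square, where \<open>X\<close> and \<open>Y\<close> grow by about \<open>1\<close>.
\<close>

lemma sum_gain_ge:
  assumes "s \<le> n"
  shows "5 / 3 * n * n * s \<le> (\<Sum>i<n. \<Sum>j<n. gain s i j)"
proof -
  have diff: "5 / 6 * n * n * s \<le> (\<Sum>i<n. \<Sum>j<n. \<Sum>t<n. f (i + s) j t - f i j t)"
    if f: "\<And>i j t. i < 2 * n \<Longrightarrow> j < n \<Longrightarrow> t < n \<Longrightarrow> \<bar>f i j t - i / n\<bar> \<le> 1 / 12"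
    for f :: "nat \<Rightarrow> nat \<Rightarrow> nat \<Rightarrow> real"
  proof -
    have shift: "(\<Sum>i<s. f (n + i) j t - f i j t) = (\<Sum>i<n. f (i + s) j t - f i j t)" for j t
      by (rule sum_shift_difference[symmetric])
    have "5 / 6 * n * n * s = (\<Sum>j<n. \<Sum>t<n. \<Sum>i<s. 5 / 6 :: real)" by simp
    also have "\<dots> \<le> (\<Sum>j<n. \<Sum>t<n. \<Sum>i<s. f (n + i) j t - f i j t)"
    proof (intro sum_mono)
      fix j t i assume "j \<in> {..<n}" "t \<in> {..<n}" "i \<in> {..<s}"
      then have "\<bar>f (n + i) j t - (n + i) / n\<bar> \<le> 1 / 12" "\<bar>f i j t - i / n\<bar> \<le> 1 / 12"
        using f[of "n + i" j t] f[of i j t] assms by auto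
      moreover have "(n + i) / n = 1 + i / n" using n_pos by (simp add: field_simps)
      ultimately show "5 / 6 \<le> f (n + i) j t - f i j t" by linarith
    qed
    also have "\<dots> = (\<Sum>j<n. \<Sum>t<n. \<Sum>i<n. f (i + s) j t - f i j t)"
      by (simp only: shift)
    also have "\<dots> = (\<Sum>j<n. \<Sum>i<n. \<Sum>t<n. f (i + s) j t - f i j t)"
      by (subst sum.swap) rule
    also have "\<dots> = (\<Sum>i<n. \<Sum>j<n. \<Sum>t<n. f (i + s) j t - f i j t)"
      by (rule sum.swap)
    finally show ?thesis .
  qed
  have "5 / 6 * n * n * s \<le> (\<Sum>i<n. \<Sum>j<n. \<Sum>t<n. X (\<kappa> (i + s) j t) - X (\<kappa> i j t))"
    by (rule diff[of "\<lambda>i j t. X (\<kappa> i j t)"]) (use near in auto)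
  moreover have "5 / 6 * n * n * s \<le> (\<Sum>j<n. \<Sum>i<n. \<Sum>t<n. Y (\<kappa> i (j + s) t) - Y (\<kappa> i j t))"
    by (rule diff[of "\<lambda>j i t. Y (\<kappa> i j t)"]) (use near in auto)
  then have "5 / 6 * n * n * s \<le> (\<Sum>i<n. \<Sum>j<n. \<Sum>t<n. Y (\<kappa> i (j + s) t) - Y (\<kappa> i j t))"
    by (subst sum.swap)
  ultimately show ?thesis
    unfolding gain_def by (simp add: sum.distrib)
qed

lemma sum_gain_le:
  assumes s: "s \<le> n" and ab: "a + 2 * s \<le> b"
  shows "(\<Sum>i<n. \<Sum>j<n. gain s i j)
           \<le> n * n * (s * (13 / 12) + 12 * N * a) + 24 * N * s * card (exceptional a b)"
proof -
  define c where "c = s * (13 / 12) + 12 * real N * a"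
  define E where "E = exceptional a b"
  have finE: "finite E"
    by (rule finite_subset[of _ "{..<2 * n} \<times> {..<2 * n}"]) (auto simp: E_def exceptional_def)
  define E1 where "E1 = {p \<in> {..<n} \<times> {..<n}. (fst p + s, snd p) \<in> E}"
  define E2 where "E2 = {p \<in> {..<n} \<times> {..<n}. (fst p, snd p + s) \<in> E}"
  have card1: "card E1 \<le> card E"
    by (rule card_inj_on_le[of "\<lambda>p. (fst p + s, snd p)"])
      (auto simp: E1_def inj_on_def finE)
  have card2: "card E2 \<le> card E"
    by (rule card_inj_on_le[of "\<lambda>p. (fst p, snd p + s)"])
      (auto simp: E2_def inj_on_def finE)
  have gain: "gain s i j \<le> c + (if (i, j) \<in> E1 \<union> E2 then 12 * real N * s else 0)"
    if "i < n" "j < n" for i j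
  proof (cases "(i, j) \<in> E1 \<union> E2")
    case True
    have "0 \<le> c" by (simp add: c_def)
    then show ?thesis using gain_le[OF that s] True by simp
  next
    case False
    then show ?thesis
      using gain_le_unexceptional[OF that s ab] that by (auto simp: E1_def E2_def E_def c_def)
  qed
  have "(\<Sum>i<n. \<Sum>j<n. gain s i j) = (\<Sum>(i, j)\<in>{..<n} \<times> {..<n}. gain s i j)"
    by (rule sum.cartesian_product)
  also have "\<dots> \<le> (\<Sum>p\<in>{..<n} \<times> {..<n}. c + (if p \<in> E1 \<union> E2 then 12 * real N * s else 0))"
    by (intro sum_mono) (use gain in force)
  also have "\<dots> = n * n * c + (\<Sum>p\<in>({..<n} \<times> {..<n}) \<inter> (E1 \<union> E2). 12 * real N * s)"
    by (simp only: sum.distrib sum.inter_restrict finite_cartesian_product finite_lessThan) simp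
  also have "({..<n} \<times> {..<n}) \<inter> (E1 \<union> E2) = E1 \<union> E2"
    by (auto simp: E1_def E2_def)
  also have "(\<Sum>p\<in>E1 \<union> E2. 12 * real N * s) = card (E1 \<union> E2) * (12 * real N * s)" by simp
  also have "\<dots> \<le> (2 * card E) * (12 * real N * s)"
    using card1 card2 card_Un_le[of E1 E2] by (intro mult_right_mono) auto
  finally show ?thesis by (simp add: c_def E_def algebra_simps)
qed

text \<open>
For a given line and a given value, the time spent at the value falls into at most one of the disjoint
intervals between consecutive scales. So the exceptional sets of the \<open>J\<close> scales have at most
\<open>N\<close> times as many elements together as there are lines.
\<close>

lemma few_exceptional:
  assumes mono: "mono r" and J: "0 < J"
  shows "\<exists>m<J. J * card (exceptional (r m) (r (Suc m))) \<le> 4 * n * n * N"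
proof (rule ccontr)
  assume *: "\<not> ?thesis"
  define A where "A m k = {p \<in> {..<2 * n} \<times> {..<2 * n}.
      r m < level (fst p) (snd p) k \<and> level (fst p) (snd p) k \<le> r (Suc m)}" for m k
  have finA: "finite (A m k)" for m k by (simp add: A_def)
  have disj: "A m k \<inter> A m' k = {}" if "m < m'" for m m' k
    using monoD[OF mono, of "Suc m" m'] that by (fastforce simp: A_def)
  have disj: "A m k \<inter> A m' k = {}" if "m \<noteq> m'" for m m' k
    using disj[of m m' k] disj[of m' m k] that by (cases "m < m'") auto
  have "card (exceptional (r m) (r (Suc m))) \<le> (\<Sum>k<N. card (A m k))" for m
  proof -
    have "exceptional (r m) (r (Suc m)) = (\<Union>k<N. A m k)"
      by (auto simp: exceptional_def A_def)
    then show ?thesis by (simp add: card_UN_le)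
  qed
  then have "(\<Sum>m<J. card (exceptional (r m) (r (Suc m)))) \<le> (\<Sum>m<J. \<Sum>k<N. card (A m k))"
    by (intro sum_mono)
  also have "\<dots> = (\<Sum>k<N. \<Sum>m<J. card (A m k))" by (rule sum.swap)
  also have "\<dots> \<le> (\<Sum>k<N. 2 * n * (2 * n))"
  proof (rule sum_mono)
    fix k
    have "(\<Sum>m<J. card (A m k)) = card (\<Union>m<J. A m k)"
      by (rule card_UN_disjoint[symmetric]) (use finA disj in auto)
    also have "\<dots> \<le> card ({..<2 * n} \<times> {..<2 * n})"
      by (rule card_mono) (auto simp: A_def)
    finally show "(\<Sum>m<J. card (A m k)) \<le> 2 * n * (2 * n)" by simp
  qed
  finally have "(\<Sum>m<J. card (exceptional (r m) (r (Suc m)))) \<le> 4 * n * n * N"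
    by (simp add: algebra_simps)
  then have "(\<Sum>m<J. J * card (exceptional (r m) (r (Suc m)))) \<le> J * (4 * n * n * N)"
    by (simp only: flip: sum_distrib_left) simp
  moreover have "(\<Sum>m<J. 4 * n * n * N) < (\<Sum>m<J. J * card (exceptional (r m) (r (Suc m))))"
    by (rule sum_strict_mono) (use * J in \<open>auto simp: not_le\<close>)
  ultimately show False by simp
qed

text \<open>
The scales are the powers of \<open>q\<^sup>2\<close> with \<open>q = 48 N\<close>, and the step \<open>s\<close> is the geometric mean of two
consecutive ones. The total gain is at least \<open>5/3\<close>, in units of \<open>n\<^sup>2 s\<close>, but at most \<open>13/12\<close>, which
bounds the growth of \<open>T\<close> along a vertical line, plus an error \<open>1/4\<close> from the deviations and an error \<open>1/8\<close> from exceptional lines.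
\<close>

theorem scales_exclude_quantisation:
  assumes n: "n = (48 * N) ^ (2 * J)" and J: "J = 768 * N * N"
  shows False
proof -
  define q where "q = 48 * N"
  have "0 < N" using index[of 0 0 0] n_pos by auto
  then have q: "48 \<le> q" and "0 < J" by (auto simp: q_def J)
  have "mono (\<lambda>m. q ^ (2 * m))"
    using q by (intro monoI power_increasing) auto
  from few_exceptional[OF this \<open>0 < J\<close>] obtain m where m: "m < J"
    and few: "J * card (exceptional (q ^ (2 * m)) (q ^ (2 * Suc m))) \<le> 4 * n * n * N"
    by auto
  define a where "a = q ^ (2 * m)"
  define s where "s = q * a"
  define E where "E = card (exceptional a (q * s))"
  have b: "q ^ (2 * Suc m) = q * s" by (simp add: s_def a_def)
  have "q * s \<le> n"
    unfolding b[symmetric] n q_def[symmetric] using m q by (intro power_increasing) auto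
  moreover have s_le: "48 * s \<le> q * s" using q by simp
  ultimately have "s \<le> n" by linarith
  have "0 < a" using q by (simp add: a_def)
  then have "0 < s" using q by (simp add: s_def)
  have "a \<le> s" using q by (simp add: s_def)
  have "a + 2 * s \<le> q * s" using \<open>a \<le> s\<close> s_le by linarith
  from order_trans[OF sum_gain_ge[OF \<open>s \<le> n\<close>] sum_gain_le[OF \<open>s \<le> n\<close> this]]
  have "5 / 3 * n * n * s \<le> n * n * (s * (13 / 12) + 12 * real N * a) + 24 * real N * s * E"
    by (simp add: E_def)
  moreover have "n * n * (s * (13 / 12) + 12 * real N * a) = 4 / 3 * (real n * n * s)"
    by (simp add: s_def q_def algebra_simps)
  moreover have "24 * real N * s * E \<le> n * n * s * (1 / 8)"
  proof -
    have "J * E \<le> 4 * n * n * N"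
      using few unfolding b a_def[symmetric] E_def .
    then have "N * (192 * N * E) \<le> N * (n * n)"
      by (simp add: J algebra_simps)
    then have "192 * N * E \<le> n * n" using \<open>0 < N\<close> by simp
    then have "192 * real N * E \<le> n * n"
      by (metis of_nat_le_iff of_nat_mult of_nat_numeral)
    then have "s * (192 * real N * E) \<le> s * (real n * n)" by (intro mult_left_mono) auto
    then show ?thesis by (simp add: algebra_simps)
  qed
  ultimately have "5 / 3 * (real n * n * s) \<le> 35 / 24 * (real n * n * s)"
    unfolding of_nat_mult by linarith
  moreover have "0 < real n * n * s" using n_pos \<open>0 < s\<close> by simp
  ultimately show False by simp
qed

end

section \<open>Space-time events\<close>

text \<open>
An event has two coordinates of space and one of time. Light travels at unit speed in the sum norm.
\<close>

type_synonym event = "real \<times> real \<times> real"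

definition precedes :: "event \<Rightarrow> event \<Rightarrow> bool"  (infix "\<preceq>" 50) where
  "p \<preceq> q \<longleftrightarrow> (case p of (x, y, t) \<Rightarrow> case q of (x', y', t') \<Rightarrow> \<bar>x' - x\<bar> + \<bar>y' - y\<bar> \<le> t' - t)"

definition strictly_precedes :: "event \<Rightarrow> event \<Rightarrow> bool"  (infix "\<prec>" 50) where
  "p \<prec> q \<longleftrightarrow> (case p of (x, y, t) \<Rightarrow> case q of (x', y', t') \<Rightarrow> \<bar>x' - x\<bar> + \<bar>y' - y\<bar> < t' - t)"

definition earlier :: "real \<Rightarrow> event \<Rightarrow> event" where
  "earlier \<epsilon> p = (case p of (x, y, t) \<Rightarrow> (x, y, t - \<epsilon>))"

lemma precedes_simp [simp]: "(x, y, t) \<preceq> (x', y', t') \<longleftrightarrow> \<bar>x' - x\<bar> + \<bar>y' - y\<bar> \<le> t' - t"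
  by (simp add: precedes_def)

lemma earlier_simp [simp]: "earlier \<epsilon> (x, y, t) = (x, y, t - \<epsilon>)"
  by (simp add: earlier_def)

lemma precedes_iff:
  "p \<preceq> q \<longleftrightarrow> \<bar>fst q - fst p\<bar> + \<bar>fst (snd q) - fst (snd p)\<bar> \<le> snd (snd q) - snd (snd p)"
  by (simp add: precedes_def case_prod_beta)

lemma strictly_precedes_iff:
  "p \<prec> q \<longleftrightarrow> \<bar>fst q - fst p\<bar> + \<bar>fst (snd q) - fst (snd p)\<bar> < snd (snd q) - snd (snd p)"
  by (simp add: strictly_precedes_def case_prod_beta)

lemma earlier_eq: "earlier \<epsilon> p = (fst p, fst (snd p), snd (snd p) - \<epsilon>)"
  by (simp add: earlier_def case_prod_beta)

lemma precedes_refl [simp]: "p \<preceq> p"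
  by (simp add: precedes_iff)

lemma precedes_antisym: "p \<preceq> q \<Longrightarrow> q \<preceq> p \<Longrightarrow> p = q"
  unfolding precedes_iff prod_eq_iff by (intro conjI; linarith)

lemma precedes_trans [trans]: "p \<preceq> q \<Longrightarrow> q \<preceq> r \<Longrightarrow> p \<preceq> r"
  unfolding precedes_iff by linarith

lemma strictly_precedes_imp_precedes: "p \<prec> q \<Longrightarrow> p \<preceq> q"
  by (simp add: precedes_iff strictly_precedes_iff)

lemma strictly_precedes_precedes_trans: "p \<prec> q \<Longrightarrow> q \<preceq> r \<Longrightarrow> p \<prec> r"
  unfolding precedes_iff strictly_precedes_iff by linarith

lemma precedes_strictly_precedes_trans: "p \<preceq> q \<Longrightarrow> q \<prec> r \<Longrightarrow> p \<prec> r"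
  unfolding precedes_iff strictly_precedes_iff by linarith

lemma not_strictly_precedes_self [simp]: "\<not> p \<prec> p"
  by (simp add: strictly_precedes_iff)

lemma earlier_mono: "p \<preceq> q \<Longrightarrow> earlier \<epsilon> p \<preceq> earlier \<epsilon> q"
  by (simp add: precedes_iff earlier_eq)

lemma earlier_precedes: "0 \<le> \<epsilon> \<Longrightarrow> earlier \<epsilon> p \<preceq> p"
  by (simp add: precedes_iff earlier_eq)

lemma earlier_strictly_precedes: "0 < \<epsilon> \<Longrightarrow> earlier \<epsilon> p \<prec> p"
  by (simp add: strictly_precedes_iff earlier_eq)

lemma earlier_earlier [simp]: "earlier \<epsilon> (earlier \<eta> p) = earlier (\<epsilon> + \<eta>) p"
  by (simp add: earlier_eq)

lemma earlier_antimono: "\<epsilon> \<le> \<eta> \<Longrightarrow> earlier \<eta> p \<preceq> earlier \<epsilon> p"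
  by (simp add: precedes_iff earlier_eq)

lemma strictly_precedes_iff_slack: "p \<prec> q \<longleftrightarrow> (\<exists>\<epsilon>>0. p \<preceq> earlier \<epsilon> q)"
proof
  assume "p \<prec> q"
  then show "\<exists>\<epsilon>>0. p \<preceq> earlier \<epsilon> q"
    unfolding precedes_iff strictly_precedes_iff earlier_eq
    by (intro exI[of _ "snd (snd q) - snd (snd p) - (\<bar>fst q - fst p\<bar> + \<bar>fst (snd q) - fst (snd p)\<bar>)"]) auto
next
  assume "\<exists>\<epsilon>>0. p \<preceq> earlier \<epsilon> q"
  then show "p \<prec> q"
    using earlier_strictly_precedes precedes_strictly_precedes_trans by blast
qed

text \<open>
Space is closed but the past is open: an event can always be moved back a little in time, as
approximation from below requires.
\<close>

definition events :: "event set" where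
  "events = {0..2} \<times> {0..2} \<times> {-1<..1}"

lemma events_iff:
  "p \<in> events \<longleftrightarrow> 0 \<le> fst p \<and> fst p \<le> 2 \<and> 0 \<le> fst (snd p) \<and> fst (snd p) \<le> 2 \<and>
                -1 < snd (snd p) \<and> snd (snd p) \<le> 1"
  by (cases p) (auto simp: events_def)

lemma earlier_in_events:
  "p \<in> events \<Longrightarrow> 0 \<le> \<epsilon> \<Longrightarrow> earlier \<epsilon> p \<in> events \<longleftrightarrow> \<epsilon> < 1 + snd (snd p)"
  by (auto simp: events_iff earlier_eq)

lemma earlier_in_events_mono:
  "earlier \<epsilon> p \<in> events \<Longrightarrow> q \<in> events \<Longrightarrow> p \<preceq> q \<Longrightarrow> 0 \<le> \<epsilon> \<Longrightarrow> earlier \<epsilon> q \<in> events"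
  unfolding events_iff earlier_eq precedes_iff by auto

lemma earlier_in_events_antimono:
  "earlier \<eta> p \<in> events \<Longrightarrow> p \<in> events \<Longrightarrow> 0 \<le> \<epsilon> \<Longrightarrow> \<epsilon> \<le> \<eta> \<Longrightarrow> earlier \<epsilon> p \<in> events"
  unfolding events_iff earlier_eq by auto

lemma ex_earlier_in_events:
  assumes "p \<in> events" "0 < \<eta>"
  shows "\<exists>\<epsilon>>0. \<epsilon> \<le> \<eta> \<and> earlier \<epsilon> p \<in> events"
proof -
  define \<epsilon> where "\<epsilon> = min \<eta> ((1 + snd (snd p)) / 2)"
  have t: "-1 < snd (snd p)" using assms(1) by (simp add: events_iff)
  then have "0 < \<epsilon>" "\<epsilon> \<le> \<eta>" using assms(2) by (auto simp: \<epsilon>_def)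
  have "\<epsilon> \<le> (1 + snd (snd p)) / 2" unfolding \<epsilon>_def by (rule min.cobounded2)
  then have "\<epsilon> < 1 + snd (snd p)" using t by (simp add: field_simps)
  then show ?thesis
    using earlier_in_events[OF assms(1), of \<epsilon>] \<open>0 < \<epsilon>\<close> \<open>\<epsilon> \<le> \<eta>\<close> by auto
qed

text \<open>
The times in a directed set of events converge to their supremum \<open>t\<close>. Later events of the set differ in
space by no more than they differ in time, so the space coordinates form a Cauchy net with the explicit limit
\<open>Sup {f p - (t - time p)}\<close> for each coordinate \<open>f\<close>. That the events approach their supremum also
from the inside of the light cone yields the description of the way-below relation.
\<close>

lemma directed_events_limit:
  assumes P: "P \<subseteq> events" "P \<noteq> {}"
    and dir: "\<And>p q. p \<in> P \<Longrightarrow> q \<in> P \<Longrightarrow> \<exists>r\<in>P. p \<preceq> r \<and> q \<preceq> r"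
  obtains s where "s \<in> events" "\<And>p. p \<in> P \<Longrightarrow> p \<preceq> s"
    "\<And>\<epsilon>. 0 < \<epsilon> \<Longrightarrow> \<exists>p\<in>P. earlier \<epsilon> s \<preceq> p"
    "\<And>u. (\<And>p. p \<in> P \<Longrightarrow> p \<preceq> u) \<Longrightarrow> s \<preceq> u"
proof -
  define time :: "event \<Rightarrow> real" where "time p = snd (snd p)" for p
  define t where "t = Sup (time ` P)"
  have bdd: "bdd_above (time ` P)"
    using P by (intro bdd_aboveI[of _ 1]) (auto simp: time_def events_iff)
  have time_le: "time p \<le> t" if "p \<in> P" for p
    unfolding t_def using that bdd by (intro cSup_upper) auto
  have late: "\<exists>p\<in>P. t - time p < \<epsilon>" if "0 < \<epsilon>" for \<epsilon>
  proof -
    have "t - \<epsilon> < Sup (time ` P)" using that by (simp add: t_def)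
    then obtain p where "p \<in> P" "t - \<epsilon> < time p"
      using less_cSupE[of "t - \<epsilon>" "time ` P"] P(2) by blast
    then show ?thesis by (auto intro!: bexI[of _ p])
  qed
  have limit: "\<exists>l. \<forall>p\<in>P. \<bar>l - f p\<bar> \<le> t - time p"
    if f: "\<And>p q. p \<in> P \<Longrightarrow> q \<in> P \<Longrightarrow> p \<preceq> q \<Longrightarrow> \<bar>f q - f p\<bar> \<le> time q - time p"
    for f :: "event \<Rightarrow> real"
  proof (intro exI ballI)
    define g where "g p = f p - (t - time p)" for p
    have g_le: "g p \<le> f q + (t - time q)" if pq: "p \<in> P" "q \<in> P" for p q
    proof -
      obtain r where r: "r \<in> P" "p \<preceq> r" "q \<preceq> r" using dir[OF pq] by blast
      then show ?thesis
        using f[OF pq(1) r(1,2)] f[OF pq(2) r(1,3)] time_le[OF r(1)] unfolding g_def by linarith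
    qed
    have bdd_g: "bdd_above (g ` P)"
      using g_le P(2) by (meson bdd_aboveI2 ex_in_conv)
    fix q assume q: "q \<in> P"
    have "Sup (g ` P) \<le> f q + (t - time q)" using g_le q P(2) by (intro cSUP_least)
    moreover have "g q \<le> Sup (g ` P)" using q bdd_g by (intro cSup_upper) auto
    ultimately show "\<bar>Sup (g ` P) - f q\<bar> \<le> t - time q" by (simp add: g_def)
  qed
  obtain x where x: "\<And>p. p \<in> P \<Longrightarrow> \<bar>x - fst p\<bar> \<le> t - time p"
    using limit[of fst] unfolding precedes_iff time_def by fastforce
  obtain y where y: "\<And>p. p \<in> P \<Longrightarrow> \<bar>y - fst (snd p)\<bar> \<le> t - time p"
    using limit[of "\<lambda>p. fst (snd p)"] unfolding precedes_iff time_def by fastforce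
  define s where "s = (x, y, t)"
  have range: "0 \<le> l \<and> l \<le> 2"
    if l: "\<And>p. p \<in> P \<Longrightarrow> \<bar>l - f p\<bar> \<le> t - time p" "\<And>p. p \<in> P \<Longrightarrow> 0 \<le> f p \<and> f p \<le> 2"
    for l :: real and f
  proof
    have "0 \<le> l + \<epsilon> \<and> l \<le> 2 + \<epsilon>" if \<epsilon>: "0 < \<epsilon>" for \<epsilon>
    proof -
      obtain p where p: "p \<in> P" "t - time p < \<epsilon>" using late[OF \<epsilon>] by blast
      then show ?thesis using l(1)[OF p(1)] l(2)[OF p(1)] by linarith
    qed
    then show "0 \<le> l" "l \<le> 2" by (auto intro: field_le_epsilon)
  qed
  have P_range: "0 \<le> fst p \<and> fst p \<le> 2" "0 \<le> fst (snd p) \<and> fst (snd p) \<le> 2" if "p \<in> P" for p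
    using subsetD[OF P(1) that] by (simp_all add: events_iff)
  have s_events: "s \<in> events"
  proof -
    have "0 \<le> x \<and> x \<le> 2" using range[of x fst] x P_range by blast
    moreover have "0 \<le> y \<and> y \<le> 2" using range[of y "\<lambda>p. fst (snd p)"] y P_range by blast
    moreover have "t \<le> 1"
      unfolding t_def using P by (intro cSup_least) (auto simp: time_def events_iff)
    moreover have "-1 < t"
    proof -
      obtain p where "p \<in> P" using P(2) by blast
      then have "-1 < time p" using P(1) by (auto simp: time_def events_iff)
      then show ?thesis using time_le[OF \<open>p \<in> P\<close>] by simp
    qed
    ultimately show ?thesis by (simp add: s_def events_iff)
  qed
  have upper: "p \<preceq> s" if p: "p \<in> P" for p
  proof -
    have "\<bar>x - fst p\<bar> + \<bar>y - fst (snd p)\<bar> \<le> t - time p + \<epsilon>" if \<epsilon>: "0 < \<epsilon>" for \<epsilon>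
    proof -
      obtain q where q: "q \<in> P" "t - time q < \<epsilon>" using late[OF \<epsilon>] by blast
      obtain r where r: "r \<in> P" "p \<preceq> r" "q \<preceq> r" using dir[OF p q(1)] by blast
      have "\<bar>fst r - fst p\<bar> + \<bar>fst (snd r) - fst (snd p)\<bar> \<le> time r - time p" "time q \<le> time r"
        using r(2,3) unfolding precedes_iff time_def by linarith+
      then show ?thesis using x[OF r(1)] y[OF r(1)] q(2) by linarith
    qed
    then have "\<bar>x - fst p\<bar> + \<bar>y - fst (snd p)\<bar> \<le> t - time p" by (rule field_le_epsilon)
    then show ?thesis by (simp add: precedes_iff s_def time_def)
  qed
  have approx: "\<exists>p\<in>P. earlier \<epsilon> s \<preceq> p" if \<epsilon>: "0 < \<epsilon>" for \<epsilon>
  proof -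
    obtain p where p: "p \<in> P" "t - time p < \<epsilon> / 2" using late[OF half_gt_zero[OF \<epsilon>]] by blast
    have "\<bar>x - fst p\<bar> + \<bar>y - fst (snd p)\<bar> \<le> t - time p"
      using upper[OF p(1)] by (simp add: precedes_iff s_def time_def)
    then have "earlier \<epsilon> s \<preceq> p"
      using p(2) abs_minus_commute[of x "fst p"] abs_minus_commute[of y "fst (snd p)"]
      unfolding precedes_iff earlier_eq s_def time_def by simp
    then show ?thesis using p(1) by blast
  qed
  have least: "s \<preceq> u" if u: "\<And>p. p \<in> P \<Longrightarrow> p \<preceq> u" for u
  proof -
    have "\<bar>fst u - x\<bar> + \<bar>fst (snd u) - y\<bar> \<le> snd (snd u) - t + \<epsilon>" if \<epsilon>: "0 < \<epsilon>" for \<epsilon>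
    proof -
      obtain p where p: "p \<in> P" "t - time p < \<epsilon> / 2" using late[OF half_gt_zero[OF \<epsilon>]] by blast
      then show ?thesis
        using u[OF p(1)] upper[OF p(1)] unfolding precedes_iff s_def time_def fst_conv snd_conv
        by linarith
    qed
    then have "\<bar>fst u - x\<bar> + \<bar>fst (snd u) - y\<bar> \<le> snd (snd u) - t" by (rule field_le_epsilon)
    then show ?thesis by (simp add: precedes_iff s_def)
  qed
  show thesis by (rule that[OF s_events upper approx least])
qed

lemma finite_net_of_events:
  assumes \<epsilon>: "0 < \<epsilon>"
  obtains M where "finite M" "M \<subseteq> events"
    "\<And>p. p \<in> events \<Longrightarrow> earlier \<epsilon> p \<in> events \<Longrightarrow> \<exists>m\<in>M. earlier \<epsilon> p \<preceq> m \<and> m \<preceq> p"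
proof -
  \<comment> \<open>Rounding space coordinates moves an event by up to \<open>2\<eta>\<close>; rounding time and going back by \<open>2\<eta>\<close>
    changes the time by \<open>2\<eta>\<close> to \<open>3\<eta>\<close>, which leaves a margin of \<open>2\<eta>\<close> to \<open>\<epsilon> = 5\<eta>\<close>.\<close>
  define \<eta> where "\<eta> = \<epsilon> / 5"
  have \<eta>: "0 < \<eta>" using \<epsilon> by (simp add: \<eta>_def)
  define b where "b = \<lceil>2 / \<eta>\<rceil> + 3"
  define Z where "Z = {-b..b}"
  define M where "M = (\<lambda>(i, j, k). (\<eta> * of_int i, \<eta> * of_int j, \<eta> * of_int k)) ` (Z \<times> Z \<times> Z) \<inter> events"
  have floor: "\<eta> * of_int \<lfloor>r / \<eta>\<rfloor> \<le> r \<and> r < \<eta> * of_int \<lfloor>r / \<eta>\<rfloor> + \<eta>" for r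
  proof -
    have "of_int \<lfloor>r / \<eta>\<rfloor> \<le> r / \<eta>" "r / \<eta> < of_int \<lfloor>r / \<eta>\<rfloor> + 1" by linarith+
    then have "of_int \<lfloor>r / \<eta>\<rfloor> * \<eta> \<le> r" "r < (of_int \<lfloor>r / \<eta>\<rfloor> + 1) * \<eta>"
      unfolding pos_le_divide_eq[OF \<eta>] pos_divide_less_eq[OF \<eta>] .
    then show ?thesis by (simp add: algebra_simps)
  qed
  have Z: "\<lfloor>r / \<eta>\<rfloor> \<in> Z \<and> \<lfloor>r / \<eta>\<rfloor> - 2 \<in> Z" if "-1 \<le> r" "r \<le> 2" for r
  proof -
    have "r / \<eta> \<le> 2 / \<eta>" "- (2 / \<eta>) \<le> r / \<eta>"
      using that \<eta> by (auto simp: field_simps)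
    then show ?thesis unfolding Z_def b_def by (simp add: le_floor_iff) linarith
  qed
  show thesis
  proof
    show "finite M" "M \<subseteq> events" by (auto simp: M_def Z_def)
    fix p assume p: "p \<in> events" "earlier \<epsilon> p \<in> events"
    obtain x y t where xyt: "p = (x, y, t)" by (cases p)
    define m where "m = (\<eta> * of_int \<lfloor>x / \<eta>\<rfloor>, \<eta> * of_int \<lfloor>y / \<eta>\<rfloor>, \<eta> * of_int (\<lfloor>t / \<eta>\<rfloor> - 2))"
    have rng: "0 \<le> x" "x \<le> 2" "0 \<le> y" "y \<le> 2" "-1 < t" "t \<le> 1" "-1 < t - \<epsilon>"
      using p by (auto simp: xyt events_iff)
    have le: "earlier \<epsilon> p \<preceq> m" "m \<preceq> p"
      using floor[of x] floor[of y] floor[of t] \<eta>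
      unfolding m_def xyt earlier_simp precedes_simp by (auto simp: \<eta>_def algebra_simps)
    have "0 \<le> \<eta> * of_int \<lfloor>x / \<eta>\<rfloor>" "0 \<le> \<eta> * of_int \<lfloor>y / \<eta>\<rfloor>"
      using rng \<eta> by auto
    then have "m \<in> events"
      using rng floor[of x] floor[of y] le unfolding m_def xyt events_iff earlier_simp precedes_simp fst_conv snd_conv
      by (intro conjI; linarith)
    moreover have "m \<in> (\<lambda>(i, j, k). (\<eta> * of_int i, \<eta> * of_int j, \<eta> * of_int k)) ` (Z \<times> Z \<times> Z)"
      unfolding m_def
      by (rule image_eqI[of _ _ "(\<lfloor>x / \<eta>\<rfloor>, \<lfloor>y / \<eta>\<rfloor>, \<lfloor>t / \<eta>\<rfloor> - 2)"])
        (use Z[of x] Z[of y] Z[of t] rng in auto)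
    ultimately have "m \<in> M" unfolding M_def by (rule IntI[rotated])
    then show "\<exists>m\<in>M. earlier \<epsilon> p \<preceq> m \<and> m \<preceq> p" using le by blast
  qed
qed

lemma precedes_of_earlier:
  assumes "\<And>\<epsilon>. 0 < \<epsilon> \<Longrightarrow> \<exists>\<eta>\<le>\<epsilon>. earlier \<eta> p \<preceq> q"
  shows "p \<preceq> q"
proof -
  have "\<bar>fst q - fst p\<bar> + \<bar>fst (snd q) - fst (snd p)\<bar> \<le> snd (snd q) - snd (snd p) + \<epsilon>"
    if \<epsilon>: "0 < \<epsilon>" for \<epsilon>
  proof -
    obtain \<eta> where "\<eta> \<le> \<epsilon>" "earlier \<eta> p \<preceq> q" using assms[OF \<epsilon>] by blast
    then show ?thesis by (simp add: precedes_iff earlier_eq)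
  qed
  then show ?thesis unfolding precedes_iff by (rule field_le_epsilon)
qed

section \<open>The identity of space-time has no finite-valued approximation\<close>

text \<open>
Comparable distinct events have different times, so listing the values of \<open>\<delta>\<close> by time numbers them
compatibly with the order. Restricted to a grid with the parameters fixed by the
number \<open>N\<close> of values, \<open>\<delta>\<close> becomes a quantised grid.
\<close>

theorem no_finite_valued_approximation:
  fixes \<delta> :: "event \<Rightarrow> event"
  defines "W \<equiv> {0..2} \<times> {0..2} \<times> {0..1}"
  assumes fin: "finite (\<delta> ` W)"
    and mono: "\<And>p q. p \<in> W \<Longrightarrow> q \<in> W \<Longrightarrow> p \<preceq> q \<Longrightarrow> \<delta> p \<preceq> \<delta> q"
    and near: "\<And>p. p \<in> W \<Longrightarrow> \<delta> p \<preceq> p \<and> earlier (1 / 12) p \<preceq> \<delta> p"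
  shows False
proof -
  obtain xs where xs: "set xs = \<delta> ` W" "distinct xs"
    using finite_distinct_list[OF fin] by blast
  define time :: "event \<Rightarrow> real" where "time p = snd (snd p)" for p
  define vs where "vs = sort_key time xs"
  have vs: "set vs = \<delta> ` W" "distinct vs" "sorted (map time vs)"
    using xs by (simp_all add: vs_def)
  define N where "N = length vs"
  define ind where "ind p = (SOME k. k < N \<and> vs ! k = \<delta> p)" for p
  have ind: "ind p < N \<and> vs ! ind p = \<delta> p" if "p \<in> W" for p
    unfolding ind_def by (rule someI_ex) (use that vs in \<open>auto simp: N_def in_set_conv_nth\<close>)
  have ind_mono: "ind p \<le> ind q" if "p \<in> W" "q \<in> W" "p \<preceq> q" for p q
  proof (rule ccontr)
    assume less: "\<not> ind p \<le> ind q"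
    then have "time (\<delta> q) \<le> time (\<delta> p)"
      using sorted_nth_mono[OF vs(3), of "ind q" "ind p"] ind that by (auto simp: N_def)
    then have "\<delta> p = \<delta> q"
      using mono[OF that] by (cases "\<delta> p"; cases "\<delta> q") (auto simp: time_def)
    then have "ind p = ind q"
      using ind that vs(2) by (metis N_def nth_eq_iff_index_eq)
    then show False using less by simp
  qed
  define J where "J = 768 * N * N"
  define n where "n = (48 * N) ^ (2 * J)"
  have "(0, 0, 0) \<in> W" by (simp add: W_def)
  then have "0 < N" using ind by fastforce
  then have n_pos: "0 < n" by (simp add: n_def)
  define pt :: "nat \<Rightarrow> nat \<Rightarrow> nat \<Rightarrow> event" where "pt i j t = (i / n, j / n, t / n)" for i j t
  have pt: "pt i j t \<in> W" if "i < 2 * n" "j < 2 * n" "t < n" for i j t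
  proof -
    have "real i \<le> 2 * n" "real j \<le> 2 * n" "real t \<le> n" using that by linarith+
    then show ?thesis using n_pos by (simp add: pt_def W_def divide_simps)
  qed
  have pt_mono: "pt i j t \<preceq> pt i' j' t'" if "\<bar>int i' - int i\<bar> + \<bar>int j' - int j\<bar> \<le> int t' - int t"
    for i j t i' j' t'
  proof -
    have "real_of_int (\<bar>int i' - int i\<bar> + \<bar>int j' - int j\<bar>) \<le> real_of_int (int t' - int t)"
      using that by (simp only: of_int_le_iff)
    then have "(\<bar>real i' - real i\<bar> + \<bar>real j' - real j\<bar>) / n \<le> (real t' - real t) / n"
      by (intro divide_right_mono) auto
    then show ?thesis by (simp add: pt_def add_divide_distrib abs_divide flip: diff_divide_distrib)
  qed
  have close: "\<bar>x' - x\<bar> \<le> 1 / 24 \<and> \<bar>y' - y\<bar> \<le> 1 / 24 \<and> t - 1 / 12 \<le> t' \<and> t' \<le> t"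
    if "(x, y, t) \<in> W" "\<delta> (x, y, t) = (x', y', t')" for x y t x' y' t'
    using near[OF that(1)] abs_minus_commute[of x x'] abs_minus_commute[of y y']
    unfolding that(2) precedes_simp earlier_simp by (intro conjI; linarith)
  interpret quantised_grid n N "\<lambda>i j t. ind (pt i j t)"
    "\<lambda>k. fst (vs ! k)" "\<lambda>k. fst (snd (vs ! k))" "\<lambda>k. snd (snd (vs ! k))"
  proof
    show "0 < n" by (rule n_pos)
    show "ind (pt i j t) < N" if "i < 2 * n" "j < 2 * n" "t < n" for i j t
      using ind pt that by blast
    show "ind (pt i j t) \<le> ind (pt i' j' t') \<and>
        \<bar>fst (vs ! ind (pt i' j' t')) - fst (vs ! ind (pt i j t))\<bar> +
        \<bar>fst (snd (vs ! ind (pt i' j' t'))) - fst (snd (vs ! ind (pt i j t)))\<bar>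
        \<le> snd (snd (vs ! ind (pt i' j' t'))) - snd (snd (vs ! ind (pt i j t)))"
      if "i < 2 * n" "j < 2 * n" "t < n" "i' < 2 * n" "j' < 2 * n" "t' < n"
        "\<bar>int i' - int i\<bar> + \<bar>int j' - int j\<bar> \<le> int t' - int t" for i j t i' j' t'
    proof -
      have le: "pt i j t \<preceq> pt i' j' t'" and W: "pt i j t \<in> W" "pt i' j' t' \<in> W"
        using pt_mono pt that by auto
      show ?thesis
        using ind_mono[OF W le] mono[OF W le] ind[OF W(1)] ind[OF W(2)]
        by (simp add: precedes_def case_prod_beta)
    qed
    show "\<bar>fst (vs ! ind (pt i j t)) - i / n\<bar> \<le> 1 / 12 \<and>
        \<bar>fst (snd (vs ! ind (pt i j t))) - j / n\<bar> \<le> 1 / 12 \<and>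
        t / n - 1 / 12 \<le> snd (snd (vs ! ind (pt i j t))) \<and> snd (snd (vs ! ind (pt i j t))) \<le> t / n"
      if "i < 2 * n" "j < 2 * n" "t < n" for i j t
      using pt[OF that] close[of "i / n" "j / n" "t / n"] ind[of "pt i j t"]
      by (cases "\<delta> (pt i j t)") (fastforce simp: pt_def)
    show "\<bar>fst (vs ! k)\<bar> \<le> 3 \<and> \<bar>fst (snd (vs ! k))\<bar> \<le> 3" if "k < N" for k
    proof -
      have "vs ! k \<in> \<delta> ` W" using that vs(1) nth_mem by (auto simp: N_def)
      then obtain x y t where W: "(x, y, t) \<in> W" "vs ! k = \<delta> (x, y, t)" by auto
      obtain x' y' t' where \<delta>: "\<delta> (x, y, t) = (x', y', t')" by (cases "\<delta> (x, y, t)")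
      have "0 \<le> x" "x \<le> 2" "0 \<le> y" "y \<le> 2" using W(1) by (auto simp: W_def)
      then have "\<bar>x'\<bar> \<le> 3" "\<bar>y'\<bar> \<le> 3" using close[OF W(1) \<delta>] by linarith+
      then show ?thesis by (simp add: W(2) \<delta>)
    qed
  qed
  show False
    by (rule scales_exclude_quantisation[of J]) (simp_all add: n_def J_def)
qed

section \<open>The domain of events\<close>

declare split_paired_All [simp del] split_paired_Ex [simp del]

text \<open>
The events are embedded into a type that need not be that of events, and a bottom element is added.
\<close>

definition spacetime :: "(event \<Rightarrow> 'a) \<Rightarrow> 'a \<Rightarrow> 'a gorder" where
  "spacetime enc btm =
     \<lparr>carrier = insert btm (enc ` events),
      eq = (=),
      le = (\<lambda>u v. u = btm \<or> (\<exists>p q. u = enc p \<and> v = enc q \<and> p \<preceq> q))\<rparr>"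

locale encoded_spacetime =
  fixes enc :: "event \<Rightarrow> 'a" and btm :: 'a
  assumes inj_enc: "inj enc" and btm_fresh: "btm \<notin> range enc"
begin

abbreviation D :: "'a gorder" where "D \<equiv> spacetime enc btm"

lemma enc_eq_iff [simp]: "enc p = enc q \<longleftrightarrow> p = q"
  using inj_enc by (auto dest: injD)

lemma enc_neq_btm [simp]: "enc p \<noteq> btm" "btm \<noteq> enc p"
  using btm_fresh by auto

lemma carrier_D: "carrier D = insert btm (enc ` events)"
  by (simp add: spacetime_def)

lemma in_carrier [simp]: "btm \<in> carrier D" "enc p \<in> carrier D \<longleftrightarrow> p \<in> events"
  by (auto simp: carrier_D)

lemma carrier_cases:
  assumes "u \<in> carrier D"
  obtains "u = btm" | p where "p \<in> events" "u = enc p"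
  using assms by (auto simp: carrier_D)

lemma le_simps [simp]:
  "btm \<sqsubseteq>\<^bsub>D\<^esub> u" "enc p \<sqsubseteq>\<^bsub>D\<^esub> enc q \<longleftrightarrow> p \<preceq> q" "\<not> enc p \<sqsubseteq>\<^bsub>D\<^esub> btm"
  by (auto simp: spacetime_def)

lemma le_enc_cases:
  assumes "enc p \<sqsubseteq>\<^bsub>D\<^esub> u"
  obtains q where "u = enc q" "p \<preceq> q"
  using assms by (auto simp: spacetime_def)

lemma partial_order_D: "partial_order D"
proof (unfold_locales, goal_cases)
  case (5 u v)
  then have "u = v" by (auto elim!: carrier_cases simp: precedes_antisym)
  then show ?case by (simp add: spacetime_def)
next
  case (6 u v w)
  then show ?case by (auto elim!: carrier_cases intro: precedes_trans)
next
  case (4 u)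
  then show ?case by (auto elim!: carrier_cases)
qed (auto simp: spacetime_def)

lemma ex_event_in_directed:
  assumes "directed_in D A" "A \<noteq> {btm}"
  shows "\<exists>p. enc p \<in> A"
proof (rule ccontr)
  assume "\<not> ?thesis"
  then have "A \<subseteq> {btm}" using assms(1) by (auto simp: directed_in_def carrier_D)
  then show False using assms by (auto simp: directed_in_def)
qed

interpretation D: partial_order D by (rule partial_order_D)

lemma directed_D_limit:
  assumes A: "directed_in D A" and p0: "enc p0 \<in> A"
  obtains s where "s \<in> events" "is_supremum D (enc s) A"
    "\<And>\<epsilon>. 0 < \<epsilon> \<Longrightarrow> \<exists>p. enc p \<in> A \<and> earlier \<epsilon> s \<preceq> p"
proof -
  define P where "P = {p. enc p \<in> A}"
  have A_carrier: "A \<subseteq> carrier D" using A by (simp add: directed_in_def)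
  have "p0 \<in> P" using p0 by (simp add: P_def)
  then have P: "P \<subseteq> events" "P \<noteq> {}" using A_carrier by (auto simp: P_def subset_iff)
  have dir: "\<exists>r\<in>P. p \<preceq> r \<and> q \<preceq> r" if "p \<in> P" "q \<in> P" for p q
  proof -
    obtain z where z: "z \<in> A" "enc p \<sqsubseteq>\<^bsub>D\<^esub> z" "enc q \<sqsubseteq>\<^bsub>D\<^esub> z"
      using directed_in_common_upper_bound[OF A, of "enc p" "enc q"] \<open>p \<in> P\<close> \<open>q \<in> P\<close> by (auto simp: P_def)
    then show ?thesis by (auto elim!: le_enc_cases simp: P_def)
  qed
  obtain s where s: "s \<in> events" "\<And>p. p \<in> P \<Longrightarrow> p \<preceq> s"
    "\<And>\<epsilon>. 0 < \<epsilon> \<Longrightarrow> \<exists>p\<in>P. earlier \<epsilon> s \<preceq> p" "\<And>u. (\<And>p. p \<in> P \<Longrightarrow> p \<preceq> u) \<Longrightarrow> s \<preceq> u"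
    using directed_events_limit[OF P dir] by blast
  have "is_supremum D (enc s) A"
  proof (rule is_supremumI)
    show "a \<sqsubseteq>\<^bsub>D\<^esub> enc s" if a: "a \<in> A" for a
    proof -
      have "a \<in> carrier D" using a A_carrier by blast
      then show ?thesis using a s(2) by (cases rule: carrier_cases) (auto simp: P_def)
    qed
    fix u assume u: "u \<in> carrier D" "\<And>a. a \<in> A \<Longrightarrow> a \<sqsubseteq>\<^bsub>D\<^esub> u"
    obtain q where q: "u = enc q" using u(2)[OF p0] by (rule le_enc_cases)
    have "s \<preceq> q"
    proof (rule s(4))
      fix p assume "p \<in> P"
      then show "p \<preceq> q" using u(2)[of "enc p"] q by (simp add: P_def)
    qed
    then show "enc s \<sqsubseteq>\<^bsub>D\<^esub> u" by (simp add: q)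
  qed (use A_carrier s(1) in auto)
  then show thesis using s(1,3) by (intro that) (auto simp: P_def)
qed

lemma supremum_cases:
  assumes A: "directed_in D A" and u: "is_supremum D u A"
  obtains (btm) "u = btm" "A = {btm}"
  | (event) s where "s \<in> events" "u = enc s" "\<And>\<epsilon>. 0 < \<epsilon> \<Longrightarrow> \<exists>p\<in>events. enc p \<in> A \<and> earlier \<epsilon> s \<preceq> p"
proof (cases "A = {btm}")
  case True
  then have "is_supremum D btm A" by (intro is_supremumI) auto
  then have "u = btm" using u by (intro D.is_supremum_unique)
  then show thesis using True by (rule btm)
next
  case False
  have A_carrier: "A \<subseteq> carrier D" using A by (simp add: directed_in_def)
  obtain p0 where p0: "enc p0 \<in> A" using ex_event_in_directed[OF A False] by blast
  obtain s where s: "s \<in> events" "is_supremum D (enc s) A"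
    "\<And>\<epsilon>. 0 < \<epsilon> \<Longrightarrow> \<exists>p. enc p \<in> A \<and> earlier \<epsilon> s \<preceq> p"
    using directed_D_limit[OF A p0] by blast
  have "u = enc s" using u s(2) by (rule D.is_supremum_unique)
  moreover have "\<exists>p\<in>events. enc p \<in> A \<and> earlier \<epsilon> s \<preceq> p" if \<epsilon>: "0 < \<epsilon>" for \<epsilon>
  proof -
    obtain p where p: "enc p \<in> A" "earlier \<epsilon> s \<preceq> p" using s(3)[OF \<epsilon>] by blast
    then have "p \<in> events" using A_carrier in_carrier(2) by blast
    then show ?thesis using p by blast
  qed
  ultimately show thesis using s(1) by (intro event)
qed

lemma dcpo_D: "dcpo D"
proof
  fix A assume A: "directed_in D A"
  show "\<exists>s. is_supremum D s A"
  proof (cases "A = {btm}")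
    case True
    then have "is_supremum D btm A" by (intro is_supremumI) auto
    then show ?thesis ..
  next
    case False
    obtain p0 where "enc p0 \<in> A" using ex_event_in_directed[OF A False] by blast
    then show ?thesis using directed_D_limit[OF A] by blast
  qed
qed

lemma earlier_family:
  assumes p: "p \<in> events"
  defines "A \<equiv> {enc (earlier \<epsilon> p) | \<epsilon>. 0 < \<epsilon> \<and> earlier \<epsilon> p \<in> events}"
  shows "directed_in D A" "is_supremum D (enc p) A"
proof -
  have "A \<noteq> {}" using ex_earlier_in_events[OF p, of 1] by (auto simp: A_def)
  moreover have "\<exists>z\<in>A. x \<sqsubseteq>\<^bsub>D\<^esub> z \<and> y \<sqsubseteq>\<^bsub>D\<^esub> z" if xy: "x \<in> A" "y \<in> A" for x y
  proof -
    obtain \<epsilon> \<eta> where e: "x = enc (earlier \<epsilon> p)" "0 < \<epsilon>" "earlier \<epsilon> p \<in> events"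
      "y = enc (earlier \<eta> p)" "0 < \<eta>" "earlier \<eta> p \<in> events"
      using xy by (auto simp: A_def)
    have "earlier (min \<epsilon> \<eta>) p \<in> events" using e by (auto simp: min_def)
    then have "enc (earlier (min \<epsilon> \<eta>) p) \<in> A" using e unfolding A_def by (intro CollectI exI conjI) auto
    then show ?thesis by (rule bexI[rotated]) (simp add: e earlier_antimono)
  qed
  ultimately show "directed_in D A" unfolding directed_in_def by (auto simp: A_def)
  show "is_supremum D (enc p) A"
  proof (rule is_supremumI)
    show "A \<subseteq> carrier D" "enc p \<in> carrier D" using p by (auto simp: A_def)
    show "a \<sqsubseteq>\<^bsub>D\<^esub> enc p" if "a \<in> A" for a using that by (auto simp: A_def earlier_precedes)
    fix u assume u: "u \<in> carrier D" "\<And>a. a \<in> A \<Longrightarrow> a \<sqsubseteq>\<^bsub>D\<^esub> u"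
    obtain a where a: "a \<in> A" using \<open>A \<noteq> {}\<close> by blast
    then obtain q where q: "u = enc q" using u(2)[OF a] by (auto simp: A_def elim: le_enc_cases)
    have "p \<preceq> q"
    proof (rule precedes_of_earlier)
      fix \<epsilon> :: real assume "0 < \<epsilon>"
      then obtain \<eta> where \<eta>: "0 < \<eta>" "\<eta> \<le> \<epsilon>" "earlier \<eta> p \<in> events" using ex_earlier_in_events[OF p] by blast
      then have "enc (earlier \<eta> p) \<in> A" by (auto simp: A_def)
      then have "earlier \<eta> p \<preceq> q" using u(2) q by fastforce
      then show "\<exists>\<eta>\<le>\<epsilon>. earlier \<eta> p \<preceq> q" using \<eta> by blast
    qed
    then show "enc p \<sqsubseteq>\<^bsub>D\<^esub> u" by (simp add: q)
  qed
qed

text \<open>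
The events just before \<open>q\<close> form a directed set with supremum \<open>q\<close>, so whatever is way below \<open>q\<close> precedes
it with some slack. Conversely, a directed set enters the light cone of any event that precedes
its supremum with slack.
\<close>

lemma way_below_D_iff:
  "way_below D u v \<longleftrightarrow> v \<in> carrier D \<and> (u = btm \<or> (\<exists>p q. u = enc p \<and> v = enc q \<and> p \<in> events \<and> p \<prec> q))"
    (is "_ \<longleftrightarrow> ?R")
proof
  assume uv: "way_below D u v"
  have u: "u \<in> carrier D" and v: "v \<in> carrier D" using way_below_carrier[OF uv] by auto
  show ?R
    using v
  proof (cases rule: carrier_cases)
    case 1
    have "u \<sqsubseteq>\<^bsub>D\<^esub> btm" using way_below_imp_le[OF partial_order_D uv] 1 by simp
    then show ?thesis using u v by (auto elim!: carrier_cases)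
  next
    case (2 q)
    obtain \<epsilon> where \<epsilon>: "0 < \<epsilon>" "u \<sqsubseteq>\<^bsub>D\<^esub> enc (earlier \<epsilon> q)"
      using way_belowD[OF uv earlier_family[OF 2(1)]] 2(2) by auto
    from u show ?thesis
    proof (cases rule: carrier_cases)
      case (2 p)
      then have "p \<prec> q" using \<epsilon> unfolding strictly_precedes_iff_slack by auto
      then show ?thesis using 2 \<open>v = enc q\<close> v by blast
    qed (use v in simp)
  qed
next
  assume R: ?R
  show "way_below D u v"
  proof (rule way_belowI)
    show "u \<in> carrier D" "v \<in> carrier D" using R by auto
    fix A s assume A: "directed_in D A" "is_supremum D s A" "v \<sqsubseteq>\<^bsub>D\<^esub> s"
    show "\<exists>y\<in>A. u \<sqsubseteq>\<^bsub>D\<^esub> y"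
    proof (cases "u = btm")
      case True
      then show ?thesis using A(1) by (auto simp: directed_in_def)
    next
      case False
      then obtain p q where pq: "u = enc p" "v = enc q" "p \<prec> q" using R by blast
      obtain r where r: "s = enc r" "q \<preceq> r" using A(3) pq(2) by (auto elim: le_enc_cases)
      obtain \<epsilon> where \<epsilon>: "0 < \<epsilon>" "p \<preceq> earlier \<epsilon> r"
        using strictly_precedes_precedes_trans[OF pq(3) r(2)] strictly_precedes_iff_slack by blast
      from A(1,2) obtain a where "enc a \<in> A" "earlier \<epsilon> r \<preceq> a"
      proof (cases rule: supremum_cases)
        case (event s')
        then show ?thesis using that \<epsilon>(1) r(1) enc_eq_iff by metis
      qed (use r in simp)
      then show ?thesis using \<epsilon>(2) pq(1) by (auto intro!: bexI[of _ "enc a"] intro: precedes_trans)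
    qed
  qed
qed

lemma compact_D_iff: "compact_element D u \<longleftrightarrow> u = btm"
  by (auto simp: way_below_D_iff)

lemma way_below_approach:
  assumes "way_below D u (enc q)"
  shows "\<exists>\<epsilon>>0. \<forall>\<eta>. 0 < \<eta> \<longrightarrow> \<eta> \<le> \<epsilon> \<longrightarrow> u \<sqsubseteq>\<^bsub>D\<^esub> enc (earlier \<eta> q) \<and> earlier \<eta> q \<in> events"
proof -
  have q: "q \<in> events" using way_below_carrier(2)[OF assms] by simp
  obtain \<epsilon> where \<epsilon>: "0 < \<epsilon>" "earlier \<epsilon> q \<in> events" using ex_earlier_in_events[OF q, of 1] by auto
  have ev: "earlier \<eta> q \<in> events" if "0 < \<eta>" "\<eta> \<le> \<epsilon>" for \<eta>
    using earlier_in_events_antimono[OF \<epsilon>(2) q] that by simp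
  show ?thesis
  proof (cases "u = btm")
    case True
    then show ?thesis using \<epsilon>(1) ev by auto
  next
    case False
    then obtain p where p: "u = enc p" "p \<prec> q" using assms by (auto simp: way_below_D_iff)
    then obtain \<epsilon>' where \<epsilon>': "0 < \<epsilon>'" "p \<preceq> earlier \<epsilon>' q" using strictly_precedes_iff_slack by blast
    have "u \<sqsubseteq>\<^bsub>D\<^esub> enc (earlier \<eta> q)" if "\<eta> \<le> \<epsilon>'" for \<eta>
      using precedes_trans[OF \<epsilon>'(2) earlier_antimono[OF that]] p(1) by simp
    then show ?thesis using \<epsilon>(1) \<epsilon>'(1) ev by (intro exI[of _ "min \<epsilon> \<epsilon>'"]) auto
  qed
qed

text \<open>
If \<open>a\<close> and \<open>b\<close> are way below an event, then they precede it even after it has been moved back by any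
sufficiently small amount of time. There are uncountably many such amounts, so one of them avoids \<open>Q\<close>.
\<close>

lemma directed_way_below_Diff:
  assumes x: "x \<in> carrier D" and Q: "countable Q" "btm \<notin> Q"
  shows "directed_in D ({a. way_below D a x} - Q)"
  unfolding directed_in_def
proof (intro conjI ballI)
  show "{a. way_below D a x} - Q \<subseteq> carrier D" by (auto dest: way_below_carrier)
  have btm: "btm \<in> {a. way_below D a x} - Q" using x Q by (simp add: way_below_D_iff)
  then show "{a. way_below D a x} - Q \<noteq> {}" by blast
  fix a b assume "a \<in> {a. way_below D a x} - Q" "b \<in> {a. way_below D a x} - Q"
  then have ab: "way_below D a x" "way_below D b x" by auto
  from x show "\<exists>z\<in>{a. way_below D a x} - Q. a \<sqsubseteq>\<^bsub>D\<^esub> z \<and> b \<sqsubseteq>\<^bsub>D\<^esub> z"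
  proof (cases rule: carrier_cases)
    case 1
    then have "a = btm" "b = btm" using ab by (auto simp: way_below_D_iff)
    then show ?thesis using btm by auto
  next
    case (2 q)
    obtain \<epsilon> where \<epsilon>: "0 < \<epsilon>" "\<And>\<eta>. 0 < \<eta> \<Longrightarrow> \<eta> \<le> \<epsilon> \<Longrightarrow> a \<sqsubseteq>\<^bsub>D\<^esub> enc (earlier \<eta> q) \<and> earlier \<eta> q \<in> events"
      using way_below_approach ab(1) unfolding 2(2) by blast
    obtain \<epsilon>' where \<epsilon>': "0 < \<epsilon>'" "\<And>\<eta>. 0 < \<eta> \<Longrightarrow> \<eta> \<le> \<epsilon>' \<Longrightarrow> b \<sqsubseteq>\<^bsub>D\<^esub> enc (earlier \<eta> q) \<and> earlier \<eta> q \<in> events"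
      using way_below_approach ab(2) unfolding 2(2) by blast
    have inj: "inj (\<lambda>\<eta>. enc (earlier \<eta> q))" by (auto simp: inj_def earlier_eq)
    have "countable ((\<lambda>\<eta>. enc (earlier \<eta> q)) ` ((\<lambda>\<eta>. enc (earlier \<eta> q)) -` Q))"
      using Q(1) by (rule countable_subset[rotated]) auto
    then have "countable ((\<lambda>\<eta>. enc (earlier \<eta> q)) -` Q)"
      by (rule countable_image_inj_on) (rule inj_on_subset[OF inj subset_UNIV])
    moreover have "uncountable {0<..<min \<epsilon> \<epsilon>'}" using \<epsilon>(1) \<epsilon>'(1) by (simp add: uncountable_open_interval)
    ultimately have "\<not> {0<..<min \<epsilon> \<epsilon>'} \<subseteq> (\<lambda>\<eta>. enc (earlier \<eta> q)) -` Q" using countable_subset by blast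
    then obtain \<eta> where "\<eta> \<in> {0<..<min \<epsilon> \<epsilon>'}" "\<eta> \<notin> (\<lambda>\<eta>. enc (earlier \<eta> q)) -` Q" by blast
    then have \<eta>: "0 < \<eta>" "\<eta> \<le> \<epsilon>" "\<eta> \<le> \<epsilon>'" "enc (earlier \<eta> q) \<notin> Q" by auto
    have "way_below D (enc (earlier \<eta> q)) x"
      using \<epsilon>(2)[OF \<eta>(1,2)] 2 earlier_strictly_precedes[OF \<eta>(1)] by (auto simp: way_below_D_iff)
    then show ?thesis
      using \<epsilon>(2)[OF \<eta>(1,2)] \<epsilon>'(2)[OF \<eta>(1,3)] \<eta>(4) by (intro bexI[of _ "enc (earlier \<eta> q)"]) auto
  qed
qed

lemma continuous_dcpo_D: "continuous_dcpo D"
proof -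
  interpret dcpo D by (rule dcpo_D)
  have eq: "{a \<in> carrier D. way_below D a x} = {a. way_below D a x}" for x
    by (auto dest: way_below_carrier)
  show ?thesis
  proof
    fix x assume x: "x \<in> carrier D"
    show "directed_in D {a \<in> carrier D. way_below D a x}"
      using directed_way_below_Diff[OF x, of "{}"] unfolding eq by simp
    show "is_supremum D x {a \<in> carrier D. way_below D a x}"
      unfolding eq
    proof (rule is_supremumI)
      show "{a. way_below D a x} \<subseteq> carrier D" by (auto dest: way_below_carrier)
      show "a \<sqsubseteq>\<^bsub>D\<^esub> x" if "a \<in> {a. way_below D a x}" for a
        using that way_below_imp_le[OF partial_order_D] by blast
      fix u assume u: "u \<in> carrier D" "\<And>a. a \<in> {a. way_below D a x} \<Longrightarrow> a \<sqsubseteq>\<^bsub>D\<^esub> u"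
      from x show "x \<sqsubseteq>\<^bsub>D\<^esub> u"
      proof (cases rule: carrier_cases)
        case (2 q)
        show ?thesis
          unfolding 2(2)
        proof (rule is_supremum_least[OF earlier_family(2)[OF 2(1)] u(1)])
          fix a assume "a \<in> {enc (earlier \<epsilon> q) | \<epsilon>. 0 < \<epsilon> \<and> earlier \<epsilon> q \<in> events}"
          then have "way_below D a x"
            using 2 by (auto simp: way_below_D_iff earlier_strictly_precedes)
          then show "a \<sqsubseteq>\<^bsub>D\<^esub> u" using u(2) by blast
        qed
      qed simp
    qed (rule x)
  qed
qed

end

section \<open>Setting events back in time: the FS property\<close>

context encoded_spacetime
begin

interpretation D: continuous_dcpo D by (rule continuous_dcpo_D)

text \<open>
The past being open, no earliest event is available for those that would leave the interval of time;
the bottom element takes its place.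
\<close>

definition set_back :: "real \<Rightarrow> 'a \<Rightarrow> 'a" where
  "set_back \<epsilon> = (\<lambda>u\<in>carrier D.
     if u \<noteq> btm \<and> earlier \<epsilon> (inv enc u) \<in> events then enc (earlier \<epsilon> (inv enc u)) else btm)"

lemma set_back_btm [simp]: "set_back \<epsilon> btm = btm"
  by (simp add: set_back_def)

lemma set_back_enc:
  "p \<in> events \<Longrightarrow> set_back \<epsilon> (enc p) = (if earlier \<epsilon> p \<in> events then enc (earlier \<epsilon> p) else btm)"
  by (simp add: set_back_def inv_f_f[OF inj_enc])

lemma set_back_carrier: "u \<in> carrier D \<Longrightarrow> set_back \<epsilon> u \<in> carrier D"
  by (auto elim!: carrier_cases simp: set_back_enc)

lemma set_back_mono:
  assumes "0 \<le> \<epsilon>" "u \<in> carrier D" "v \<in> carrier D" "u \<sqsubseteq>\<^bsub>D\<^esub> v"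
  shows "set_back \<epsilon> u \<sqsubseteq>\<^bsub>D\<^esub> set_back \<epsilon> v"
  using assms(2)
proof (cases rule: carrier_cases)
  case (2 p)
  then obtain q where q: "v = enc q" "p \<preceq> q" using assms(4) by (auto elim: le_enc_cases)
  then have "q \<in> events" using assms(3) by simp
  then show ?thesis
    using earlier_in_events_mono[of \<epsilon> p q] earlier_mono[OF q(2)] assms(1) q 2 by (simp add: set_back_enc)
qed simp

lemma scott_continuous_set_back:
  assumes \<epsilon>: "0 \<le> \<epsilon>"
  shows "scott_continuous D D (set_back \<epsilon>)"
proof -
  have sup: "is_supremum D (set_back \<epsilon> s) (set_back \<epsilon> ` A)"
    if A: "directed_in D A" "is_supremum D s A" for A s
  proof (rule is_supremumI)
    have s: "s \<in> carrier D" using A(2) by (rule is_supremum_carrier)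
    have A_carrier: "A \<subseteq> carrier D" using A(1) by (simp add: directed_in_def)
    show "set_back \<epsilon> ` A \<subseteq> carrier D" "set_back \<epsilon> s \<in> carrier D"
      using A_carrier s set_back_carrier by auto
    show "b \<sqsubseteq>\<^bsub>D\<^esub> set_back \<epsilon> s" if b: "b \<in> set_back \<epsilon> ` A" for b
    proof -
      obtain a where a: "a \<in> A" "b = set_back \<epsilon> a" using b by blast
      then show ?thesis
        using set_back_mono[OF \<epsilon> _ s is_supremum_upper[OF A(2) A_carrier a(1)]] A_carrier by auto
    qed
    fix u assume u: "u \<in> carrier D" "\<And>b. b \<in> set_back \<epsilon> ` A \<Longrightarrow> b \<sqsubseteq>\<^bsub>D\<^esub> u"
    from A show "set_back \<epsilon> s \<sqsubseteq>\<^bsub>D\<^esub> u"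
    proof (cases rule: supremum_cases)
      case btm
      then show ?thesis by simp
    next
      case (event p)
      show ?thesis
      proof (cases "earlier \<epsilon> p \<in> events")
        case True
        have below: "\<exists>q. u = enc q \<and> earlier \<eta> (earlier \<epsilon> p) \<preceq> q"
          if \<eta>: "0 < \<eta>" "earlier \<eta> (earlier \<epsilon> p) \<in> events" for \<eta>
        proof -
          obtain r where r: "r \<in> events" "enc r \<in> A" "earlier \<eta> p \<preceq> r" using event(3)[OF \<eta>(1)] by blast
          have le: "earlier \<eta> (earlier \<epsilon> p) \<preceq> earlier \<epsilon> r"
            using earlier_mono[OF r(3), of \<epsilon>] by (simp add: add.commute)
          moreover have "earlier \<epsilon> r \<in> events"
            using le \<eta>(2) r(1) \<epsilon> unfolding events_iff precedes_iff earlier_eq by auto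
          then have "enc (earlier \<epsilon> r) \<in> set_back \<epsilon> ` A"
            using r by (intro image_eqI[of _ _ "enc r"]) (simp_all add: set_back_enc)
          from u(2)[OF this] obtain q where "u = enc q" "earlier \<epsilon> r \<preceq> q" by (rule le_enc_cases)
          ultimately show ?thesis by (blast intro: precedes_trans)
        qed
        obtain \<eta>0 where "0 < \<eta>0" "earlier \<eta>0 (earlier \<epsilon> p) \<in> events"
          using ex_earlier_in_events[OF True, of 1] by auto
        then obtain q where q: "u = enc q" using below by blast
        have "earlier \<epsilon> p \<preceq> q"
        proof (rule precedes_of_earlier)
          fix \<zeta> :: real assume "0 < \<zeta>"
          then obtain \<eta> where "0 < \<eta>" "\<eta> \<le> \<zeta>" "earlier \<eta> (earlier \<epsilon> p) \<in> events"
            using ex_earlier_in_events[OF True] by blast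
          then show "\<exists>\<eta>\<le>\<zeta>. earlier \<eta> (earlier \<epsilon> p) \<preceq> q" using below q by fastforce
        qed
        then show ?thesis by (simp add: event set_back_enc q)
      qed (simp add: event set_back_enc)
    qed
  qed
  show ?thesis
    unfolding scott_continuous_def
    using set_back_carrier set_back_mono[OF \<epsilon>] sup
    by (auto intro!: isotoneI D.weak_partial_order_axioms)
qed

lemma finitely_separated_set_back:
  assumes \<epsilon>: "0 < \<epsilon>"
  shows "finitely_separated D (set_back \<epsilon>)"
proof -
  obtain M where M: "finite M" "M \<subseteq> events"
    "\<And>p. p \<in> events \<Longrightarrow> earlier \<epsilon> p \<in> events \<Longrightarrow> \<exists>m\<in>M. earlier \<epsilon> p \<preceq> m \<and> m \<preceq> p"
    using finite_net_of_events[OF \<epsilon>] by blast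
  have "\<exists>m\<in>insert btm (enc ` M). set_back \<epsilon> u \<sqsubseteq>\<^bsub>D\<^esub> m \<and> m \<sqsubseteq>\<^bsub>D\<^esub> u" if "u \<in> carrier D" for u
    using that
  proof (cases rule: carrier_cases)
    case (2 p)
    show ?thesis
    proof (cases "earlier \<epsilon> p \<in> events")
      case True
      then obtain m where "m \<in> M" "earlier \<epsilon> p \<preceq> m" "m \<preceq> p" using M(3) 2 by blast
      then show ?thesis using 2 True by (auto simp: set_back_enc)
    qed (simp add: 2 set_back_enc)
  qed simp
  then show ?thesis
    unfolding finitely_separated_def using M(1,2)
    by (intro exI[of _ "insert btm (enc ` M)"]) auto
qed

theorem FS_domain_D: "FS_domain D"
proof -
  let ?F = "scott_function_space D D"
  define f where "f n = set_back (1 / Suc n)" for n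
  have f_mem: "f n \<in> carrier ?F" for n
    using scott_continuous_set_back[of "1 / Suc n"] set_back_carrier
    by (auto simp: scott_function_space_def f_def set_back_def)
  have f_mono: "f m \<sqsubseteq>\<^bsub>?F\<^esub> f n" if mn: "m \<le> n" for m n
  proof -
    have le: "1 / real (Suc n) \<le> 1 / real (Suc m)" using mn by (simp add: frac_le)
    have "f m u \<sqsubseteq>\<^bsub>D\<^esub> f n u" if "u \<in> carrier D" for u
      using that
    proof (cases rule: carrier_cases)
      case (2 p)
      have "earlier (1 / Suc n) p \<in> events" if "earlier (1 / Suc m) p \<in> events"
        by (rule earlier_in_events_antimono[OF that 2(1) _ le]) simp
      then show ?thesis using earlier_antimono[OF le, of p] by (simp add: f_def set_back_enc 2)
    qed (simp add: f_def)
    then show ?thesis by (simp add: scott_function_space_def)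
  qed
  have small: "\<exists>n. 1 / real (Suc n) \<le> \<epsilon>" if "0 < \<epsilon>" for \<epsilon>
    using nat_approx_posE[OF that] less_imp_le by metis
  have sup: "is_supremum D u ((\<lambda>g. g u) ` range f)" if u: "u \<in> carrier D" for u
  proof (rule is_supremumI)
    show "(\<lambda>g. g u) ` range f \<subseteq> carrier D" using u set_back_carrier by (auto simp: f_def)
    show "b \<sqsubseteq>\<^bsub>D\<^esub> u" if "b \<in> (\<lambda>g. g u) ` range f" for b
      using that u by (auto elim!: carrier_cases simp: f_def set_back_enc earlier_precedes)
    fix v assume v: "v \<in> carrier D" "\<And>b. b \<in> (\<lambda>g. g u) ` range f \<Longrightarrow> b \<sqsubseteq>\<^bsub>D\<^esub> v"
    from u show "u \<sqsubseteq>\<^bsub>D\<^esub> v"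
    proof (cases rule: carrier_cases)
      case (2 p)
      have below: "\<exists>q. v = enc q \<and> (\<exists>\<eta>\<le>\<epsilon>. earlier \<eta> p \<preceq> q)" if \<epsilon>: "0 < \<epsilon>" for \<epsilon>
      proof -
        obtain \<epsilon>' where \<epsilon>': "0 < \<epsilon>'" "\<epsilon>' \<le> \<epsilon>" "earlier \<epsilon>' p \<in> events"
          using ex_earlier_in_events[OF 2(1) \<epsilon>] by blast
        obtain n where n: "1 / real (Suc n) \<le> \<epsilon>'" using small[OF \<epsilon>'(1)] by blast
        have "earlier (1 / Suc n) p \<in> events"
          by (rule earlier_in_events_antimono[OF \<epsilon>'(3) 2(1) _ n]) simp
        then have "f n u = enc (earlier (1 / Suc n) p)" by (simp add: f_def 2 set_back_enc)
        moreover have "f n u \<sqsubseteq>\<^bsub>D\<^esub> v" by (rule v(2)) simp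
        ultimately obtain q where "v = enc q" "earlier (1 / Suc n) p \<preceq> q" by (metis le_enc_cases)
        moreover have "1 / real (Suc n) \<le> \<epsilon>" using n \<epsilon>'(2) by (rule order_trans)
        ultimately show ?thesis by blast
      qed
      obtain q where q: "v = enc q" using below[of 1] by auto
      have "p \<preceq> q" using below unfolding q enc_eq_iff by (intro precedes_of_earlier) blast
      then show ?thesis by (simp add: 2 q)
    qed simp
  qed (rule u)
  have dir: "directed_in ?F (range f)" using f_mem f_mono by (rule directed_in_chain)
  have "\<forall>g\<in>range f. finitely_separated D g"
    by (auto simp: f_def finitely_separated_set_back)
  then show ?thesis using dir sup by unfold_locales blast
qed

end

section \<open>The function space is not continuous\<close>

context encoded_spacetime
begin

text \<open>
If the function space were continuous, then some \<open>h\<close> way below the map of approximants would satisfy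
\<open>earlier (1/24) m \<in> h m\<close> for all \<open>m\<close> in a finite net. As every event \<open>p\<close> of nonnegative time lies above a point of the net
that in turn lies above \<open>earlier (1/24) p\<close>, the greatest element of \<open>h p\<close> would lie between
\<open>earlier (1/12) p\<close> and \<open>p\<close>, so these greatest elements would form a finite-valued approximation of the identity.
\<close>

theorem not_continuous_function_space:
  assumes inj: "inj_on \<iota> (carrier D)"
  shows "\<not> continuous_dcpo (scott_function_space D (directed_subsets \<iota> D))"
proof
  let ?L = "directed_subsets \<iota> D"
  let ?F = "scott_function_space D ?L" and ?s = "approximants \<iota> D {}"
  assume cont: "continuous_dcpo ?F"
  note po = partial_order_D
  have dir: "directed_in D ({a. way_below D a x} - Q)"
    if "x \<in> carrier D" "countable Q" "\<And>a. a \<in> Q \<Longrightarrow> \<not> compact_element D a" for x Q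
    using that by (intro directed_way_below_Diff) (auto simp: compact_D_iff)
  have base: "?s \<in> carrier ?F"
    by (intro approximants_in_function_space continuous_dcpo_D inj dir) auto
  define W :: "event set" where "W = {0..2} \<times> {0..2} \<times> {0..1}"
  have W: "p \<in> events" "earlier (1 / 24) p \<in> events" "earlier (1 / 12) p \<in> events" if "p \<in> W" for p
    using that by (auto simp: W_def events_def earlier_def)
  obtain M where M: "finite M" "M \<subseteq> events"
    "\<And>p. p \<in> events \<Longrightarrow> earlier (1 / 24) p \<in> events \<Longrightarrow> \<exists>m\<in>M. earlier (1 / 24) p \<preceq> m \<and> m \<preceq> p"
    using finite_net_of_events[of "1 / 24"] by auto
  define K where "K = (\<lambda>m. (enc (earlier (1 / 24) m), enc m)) ` {m \<in> M. earlier (1 / 24) m \<in> events}"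
  have "finite K" using M(1) by (simp add: K_def)
  have K: "way_below D a x" if "(a, x) \<in> K" for a x
  proof -
    obtain m where m: "m \<in> M" "earlier (1 / 24) m \<in> events" "a = enc (earlier (1 / 24) m)" "x = enc m"
      using \<open>(a, x) \<in> K\<close> by (auto simp: K_def)
    have "earlier (1 / 24) m \<prec> m" by (rule earlier_strictly_precedes) simp
    then show ?thesis using m M(2) by (auto simp: way_below_D_iff)
  qed
  obtain h where h: "way_below ?F h ?s" "\<And>a x. (a, x) \<in> K \<Longrightarrow> \<iota> a \<in> h x"
    using ex_way_below_approximant[OF continuous_dcpo_D inj base cont \<open>finite K\<close> K] by blast
  have h_mem: "h \<in> carrier ?F" using h(1) by (rule way_below_carrier)
  have h_le: "h \<sqsubseteq>\<^bsub>?F\<^esub> ?s"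
    by (rule way_below_imp_le[OF _ h(1)])
      (intro partial_order_scott_function_space po partial_order_directed_subsets)
  \<comment> \<open>The values of \<open>h\<close> as directed subsets of the domain itself, without the relabelling.\<close>
  define val where "val x = {a \<in> carrier D. \<iota> a \<in> h x}" for x
  have h_val: "directed_in D (val x)" if x: "x \<in> carrier D" for x
  proof -
    have "h x \<in> carrier ?L" using scott_function_space_carrierD(2)[OF h_mem x] .
    then obtain A where A: "directed_in D A" "h x = \<iota> ` A" by (auto simp: carrier_directed_subsets)
    then have "A \<subseteq> carrier D" by (simp add: directed_in_def)
    then have "val x = A" using inj_on_image_mem_iff[OF inj] by (auto simp: val_def A(2))
    then show ?thesis using A(1) by simp
  qed
  have val_mono: "val x \<subseteq> val y" if "x \<in> carrier D" "y \<in> carrier D" "x \<sqsubseteq>\<^bsub>D\<^esub> y" for x y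
  proof -
    have "isotone D ?L h"
      using scott_function_space_carrierD(1)[OF h_mem] by (simp add: scott_continuous_def)
    then have "h x \<subseteq> h y" using that by (auto simp: isotone_def)
    then show ?thesis by (auto simp: val_def)
  qed
  have val_below: "way_below D a x" if a: "a \<in> val x" and x: "x \<in> carrier D" for a x
  proof -
    have "\<iota> a \<in> ?s x" using a h_le x by (auto simp: val_def scott_function_space_def)
    then obtain b where b: "\<iota> a = \<iota> b" "way_below D b x" by (auto simp: approximants_eq[OF x])
    then have "a = b" using a inj way_below_carrier(1)[OF b(2)] by (auto simp: val_def dest: inj_onD)
    then show ?thesis using b by simp
  qed
  define H where "H = (\<Union>x\<in>carrier D. val x)"
  have "finite H"
  proof (rule finite_subset)
    show "H \<subseteq> insert btm {a \<in> carrier D. \<not> compact_element D a \<and> (\<exists>x\<in>carrier D. \<iota> a \<in> h x)}"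
      by (auto simp: H_def val_def compact_D_iff)
    show "finite (insert btm {a \<in> carrier D. \<not> compact_element D a \<and> (\<exists>x\<in>carrier D. \<iota> a \<in> h x)})"
      using finite_values_of_way_below_approximants[OF continuous_dcpo_D inj dir h(1)] by simp
  qed
  have net_value: "\<exists>c. enc c \<in> val (enc p) \<and> earlier (1 / 12) p \<preceq> c" if p: "p \<in> W" for p
  proof -
    obtain m where m: "m \<in> M" "earlier (1 / 24) p \<preceq> m" "m \<preceq> p" using M(3) W[OF p] by blast
    have le: "earlier (1 / 12) p \<preceq> earlier (1 / 24) m"
      using earlier_mono[OF m(2), of "1 / 24"] by simp
    have "m \<in> events" using m(1) M(2) by blast
    then have "earlier (1 / 24) m \<in> events"
      using le W(3)[OF p] unfolding events_iff precedes_iff earlier_eq by auto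
    then have "(enc (earlier (1 / 24) m), enc m) \<in> K" using m(1) by (auto simp: K_def)
    then have "enc (earlier (1 / 24) m) \<in> val (enc m)"
      using h(2) \<open>earlier (1 / 24) m \<in> events\<close> by (simp add: val_def)
    then have "enc (earlier (1 / 24) m) \<in> val (enc p)"
      using val_mono[of "enc m" "enc p"] m(3) \<open>m \<in> events\<close> W(1)[OF p] by auto
    then show ?thesis using le by blast
  qed
  have greatest: "\<exists>r. enc r \<in> val (enc p) \<and> (\<forall>a\<in>val (enc p). a \<sqsubseteq>\<^bsub>D\<^esub> enc r)" if p: "p \<in> W" for p
  proof -
    have pD: "enc p \<in> carrier D" using W(1)[OF p] by simp
    then have "val (enc p) \<subseteq> H" unfolding H_def by (rule UN_upper)
    then have "finite (val (enc p))" using \<open>finite H\<close> by (rule finite_subset)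
    then obtain z where z: "z \<in> val (enc p)" "\<forall>a\<in>val (enc p). a \<sqsubseteq>\<^bsub>D\<^esub> z"
      using directed_finite_upper_bound[OF po h_val[OF pD], of "val (enc p)"] by blast
    obtain c where "enc c \<in> val (enc p)" using net_value[OF p] by blast
    then have "enc c \<sqsubseteq>\<^bsub>D\<^esub> z" using z(2) by blast
    then obtain r where "z = enc r" by (rule le_enc_cases)
    then show ?thesis using z by blast
  qed
  define \<delta> where "\<delta> p = (SOME r. enc r \<in> val (enc p) \<and> (\<forall>a\<in>val (enc p). a \<sqsubseteq>\<^bsub>D\<^esub> enc r))" for p
  have \<delta>: "enc (\<delta> p) \<in> val (enc p)" "\<And>a. a \<in> val (enc p) \<Longrightarrow> a \<sqsubseteq>\<^bsub>D\<^esub> enc (\<delta> p)" if "p \<in> W" for p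
    using someI_ex[OF greatest[OF that]] by (auto simp: \<delta>_def)
  show False
  proof (rule no_finite_valued_approximation[of \<delta>])
    have "enc ` (\<delta> ` W) \<subseteq> H"
    proof
      fix b assume "b \<in> enc ` (\<delta> ` W)"
      then obtain p where p: "p \<in> W" "b = enc (\<delta> p)" by blast
      then have "enc p \<in> carrier D" using W(1) by simp
      then show "b \<in> H" unfolding p(2) H_def using \<delta>(1)[OF p(1)] by (rule UN_I)
    qed
    then have "finite (enc ` (\<delta> ` W))" using \<open>finite H\<close> by (rule finite_subset)
    then show "finite (\<delta> ` ({0..2} \<times> {0..2} \<times> {0..1}))"
      unfolding W_def by (rule finite_imageD) (rule inj_on_subset[OF inj_enc subset_UNIV])
  next
    fix p q assume "p \<in> {0..2} \<times> {0..2} \<times> {0..1}" "q \<in> {0..2} \<times> {0..2} \<times> {0..1}" and le: "p \<preceq> q"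
    then have pq: "p \<in> W" "q \<in> W" by (simp_all add: W_def)
    have "enc (\<delta> p) \<in> val (enc q)"
      using \<delta>(1)[OF pq(1)] val_mono[of "enc p" "enc q"] W(1)[OF pq(1)] W(1)[OF pq(2)] le by auto
    then show "\<delta> p \<preceq> \<delta> q" using \<delta>(2)[OF pq(2)] by fastforce
  next
    fix p :: event assume "p \<in> {0..2} \<times> {0..2} \<times> {0..1}"
    then have p: "p \<in> W" by (simp add: W_def)
    have "way_below D (enc (\<delta> p)) (enc p)" using val_below[OF \<delta>(1)[OF p]] W(1)[OF p] by simp
    then have "\<delta> p \<preceq> p" by (auto simp: way_below_D_iff strictly_precedes_imp_precedes)
    moreover obtain c where c: "enc c \<in> val (enc p)" "earlier (1 / 12) p \<preceq> c"
      using net_value[OF p] by blast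
    have "c \<preceq> \<delta> p" using \<delta>(2)[OF p c(1)] by simp
    ultimately show "\<delta> p \<preceq> p \<and> earlier (1 / 12) p \<preceq> \<delta> p"
      using precedes_trans[OF c(2)] by blast
  qed
qed

end

lemma ex_injection_event_real: "\<exists>j :: event \<Rightarrow> real. inj j"
proof -
  have inf: "\<not> finite (UNIV :: real set)" by (rule infinite_UNIV_char_0)
  obtain g :: "real \<times> real \<Rightarrow> real" where "bij_betw g (UNIV \<times> UNIV) UNIV"
    using card_of_Times_same_infinite[OF inf] unfolding card_of_ordIso[symmetric] by blast
  then have g: "inj g" by (simp add: bij_betw_def)
  have "inj (\<lambda>(x, yt). g (x, g yt))"
    using g by (auto simp: inj_def)
  then show ?thesis by blast
qed

theorem theorem4p20:
  shows "\<exists>(X :: real set set gorder) (L :: real set set gorder).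
           FS_domain X \<and> algebraic_domain L \<and>
           \<not> continuous_dcpo (scott_function_space X L)"
proof -
  obtain j :: "event \<Rightarrow> real" where j: "inj j" using ex_injection_event_real by blast
  \<comment> \<open>Singletons of singletons leave \<open>{}\<close> for the bottom element, and the union of an encoded event is
    an element of the smaller type that still determines it.\<close>
  define enc where "enc p = {{j p}}" for p
  interpret encoded_spacetime enc "{}"
  proof
    show "inj enc" using j by (auto simp: inj_def enc_def)
    show "{} \<notin> range enc" by (auto simp: enc_def)
  qed
  have "inj_on Union (carrier D)"
    using j by (auto simp: inj_on_def carrier_D enc_def inj_def)
  then have "algebraic_domain (directed_subsets Union D)"
    "\<not> continuous_dcpo (scott_function_space D (directed_subsets Union D))"
    by (rule algebraic_domain_directed_subsets[OF partial_order_D] not_continuous_function_space)+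
  then show ?thesis using FS_domain_D by blast
qed

end
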